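(* Let $(\mathfrak g,B,\omega)$ be a nonzero special odd-symplectic odd-Manin superalgebra. Then $\mathfrak g$ is a generalized odd double extension of a special odd-symplectic odd-Manin superalgebra $(\mathfrak h,B_{\mathfrak h},\omega_{\mathfrak h})$ by the one-dimensional Lie superalgebra with null even part.
   Context: All Lie superalgebras are finite dimensional over an algebraically closed field $\mathbb K$ of characteristic zero; $|x|\in\mathbb Z_2$ is the degree of a homogeneous $X$. A bilinear form on $\mathfrak g$ is odd if it vanishes on $\mathfrak g_\alpha\times\mathfrak g_\alpha$ for all $\alpha\in\mathbb Z_2$. An odd-quadratic structure $B$ is an odd, supersymmetric ($B(X,Y)=(-1)^{|x||y|}B(Y,X)$), invariant ($B([X,Y],Z)=B(X,[Y,Z])$), non-degenerate bilinear form. An odd-symplectic form is an odd, skew-supersymmetric ($\omega(X,Y)=-(-1)^{|x||y|}\omega(Y,X)$), non-degenerate bilinear form with $(-1)^{|z||x|}\omega(X,[Y,Z])+(-1)^{|x||y|}\omega(Y,[Z,X])+(-1)^{|y||z|}\omega(Z,[X,Y])=0$. A special odd-symplectic odd-Manin superalgebra is $(\mathfrak g=\mathfrak a\oplus\mathfrak b,B,\omega)$ where $\mathfrak a,\mathfrak b$ are Lie sub-superalgebras, the sum is a direct sum of vector spaces, $B$ is an odd-quadratic structure with $B(\mathfrak a,\mathfrak a)=B(\mathfrak b,\mathfrak b)=\{0\}$, and $\omega$ is an odd-symplectic form with $\omega(\mathfrak a,\mathfrak a)=\omega(\mathfrak b,\mathfrak b)=\{0\}$. There is then a unique even invertible superderivation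 $\delta$ with $\omega(X,Y)=B(\delta(X),Y)$, and it is skew-supersymmetric. A superderivation $\Delta$ of degree $d$ satisfies $\Delta(\mathfrak g_\alpha)\subseteq \mathfrak g_{\alpha+d}$ and $\Delta[X,Y]=[\Delta(X),Y]+(-1)^{d|x|}[X,\Delta(Y)]$; it is skew-supersymmetric for $B$ if $B(\Delta(X),Y)=-(-1)^{d|x|}B(X,\Delta(Y))$. $[\delta,\bar D]$ is the supercommutator. Generalized odd double extension by the one-dimensional Lie superalgebra with null even part. Let $(\mathfrak h,B,\omega)$ be a Lie superalgebra with an odd-quadratic structure $B$ and an odd-symplectic form $\omega=B(\delta\cdot,\cdot)$. Let $\bar D$ be an odd skew-supersymmetric superderivation of $(\mathfrak h,B)$, $x_0\in\mathfrak h_{\bar0}$, $k\in\mathbb K$, $c_1\in\mathfrak h_{\bar1}$ and $\lambda\in\mathbb K\setminus\{0\}$ such that $\bar D(x_0)=0$, $\bar D^2=\frac12\mathrm{ad}_{\mathfrak h}(x_0)$, $B(c_1,x_0)=\lambda k$, $2\bar D(c_1)=\delta(x_0)+2\lambda x_0$, $[\delta,\bar D]+\lambda\bar D=\mathrm{ad}_{\mathfrak h}(c_1)$. On $\widetilde{\mathfrak g}=\mathbb Ke^*\oplus\mathfrak h\oplus\mathbb Ke$ ($e$ odd, $e^*$ even) define the bracket by $[e,e]=x_0+ke^*$, $[e,X]=\bar D(X)+B(x_0,X)e^*$, $[X,Y]=[X,Y]_{\mathfrak h}+B(\bar D(X),Y)e^*$ for $X,Y\in\mathfrak h$, $e^*$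 central; the supersymmetric form $\widetilde B$ by $\widetilde B|_{\mathfrak h\times\mathfrak h}=B$, $\widetilde B(e^*,e)=1$, all other pairings zero; and $\Delta$ by $\Delta(e^* )=\lambda e^*$, $\Delta(X)=\delta(X)-B(c_1,X)e^*$, $\Delta(e)=-\lambda e+c_1$. Then $\widetilde{\mathfrak g}$ with $\widetilde B$ and the odd-symplectic form $\widetilde\omega(\cdot,\cdot)=\widetilde B(\Delta(\cdot),\cdot)$ is the generalized odd double extension of $(\mathfrak h,B,\omega)$ by means of $(\bar D,x_0,c_1,\lambda)$. "Is a generalized odd double extension" means up to isomorphism preserving both forms. *)

theory Defs
  imports
    "HOL-Computational_Algebra.Polynomial"
    "HOL-Library.Z2"
    "HOL-Library.Product_Plus"
begin

text \<open>
  A superalgebra lives on a subspace of an ambient vector space of type \<open>'a\<close>, so that subalgebras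
  and extensions are again values of the same kind. The group \<open>\<int>\<^sub>2\<close> of degrees is the type \<open>bit\<close>.
\<close>

record ('k, 'a) superalg =
  scl :: "'k \<Rightarrow> 'a \<Rightarrow> 'a"
  part :: "bit \<Rightarrow> 'a set"
  brac :: "'a \<Rightarrow> 'a \<Rightarrow> 'a"

text \<open>\<open>sgn2 d\<close> is the sign \<open>(-1)^d\<close>.\<close>

definition sgn2 :: "bit \<Rightarrow> 'k::field" where
  "sgn2 d = (if d = 0 then 1 else - 1)"

definition carr :: "('k, 'a::ab_group_add) superalg \<Rightarrow> 'a set" where
  "carr L = {x + y | x y. x \<in> part L 0 \<and> y \<in> part L 1}"

definition linear_between ::
  "('k::field \<Rightarrow> 'a::ab_group_add \<Rightarrow> 'a) \<Rightarrow> 'a set \<Rightarrow> ('k \<Rightarrow> 'b::ab_group_add \<Rightarrow> 'b) \<Rightarrow> 'b set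
    \<Rightarrow> ('a \<Rightarrow> 'b) \<Rightarrow> bool" where
  "linear_between s V s' W f \<longleftrightarrow>
     f ` V \<subseteq> W \<and>
     (\<forall>x\<in>V. \<forall>y\<in>V. f (x + y) = f x + f y) \<and>
     (\<forall>c. \<forall>x\<in>V. f (s c x) = s' c (f x))"

definition bilinear_between ::
  "('k::field \<Rightarrow> 'a::ab_group_add \<Rightarrow> 'a) \<Rightarrow> 'a set \<Rightarrow> ('k \<Rightarrow> 'b::ab_group_add \<Rightarrow> 'b) \<Rightarrow> 'b set
    \<Rightarrow> ('a \<Rightarrow> 'a \<Rightarrow> 'b) \<Rightarrow> bool" where
  "bilinear_between s V s' W f \<longleftrightarrow>
     (\<forall>x\<in>V. linear_between s V s' W (f x)) \<and>
     (\<forall>y\<in>V. linear_between s V s' W (\<lambda>x. f x y))"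

locale lie_superalgebra =
  fixes L :: "('k::field, 'a::ab_group_add) superalg"
  assumes vector_space: "vector_space (scl L)"
    and subspace_part: "\<And>\<alpha>. module.subspace (scl L) (part L \<alpha>)"
    and part_Int: "part L 0 \<inter> part L 1 = {0}"
    and finite_dim: "\<exists>S. finite S \<and> module.span (scl L) S = carr L"
    and bilinear_brac: "bilinear_between (scl L) (carr L) (scl L) (carr L) (brac L)"
    and brac_degree: "\<And>\<alpha> \<beta> x y. x \<in> part L \<alpha> \<Longrightarrow> y \<in> part L \<beta> \<Longrightarrow> brac L x y \<in> part L (\<alpha> + \<beta>)"
    and skew_super: "\<And>\<alpha> \<beta> x y. x \<in> part L \<alpha> \<Longrightarrow> y \<in> part L \<beta> \<Longrightarrow>
      brac L x y = - scl L (sgn2 (\<alpha> * \<beta>)) (brac L y x)"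
    and super_jacobi: "\<And>\<alpha> \<beta> \<gamma> x y z. x \<in> part L \<alpha> \<Longrightarrow> y \<in> part L \<beta> \<Longrightarrow> z \<in> part L \<gamma> \<Longrightarrow>
      scl L (sgn2 (\<gamma> * \<alpha>)) (brac L x (brac L y z)) +
      scl L (sgn2 (\<alpha> * \<beta>)) (brac L y (brac L z x)) +
      scl L (sgn2 (\<beta> * \<gamma>)) (brac L z (brac L x y)) = 0"

definition lie_subsuperalgebra :: "('k::field, 'a::ab_group_add) superalg \<Rightarrow> 'a set \<Rightarrow> bool" where
  "lie_subsuperalgebra L A \<longleftrightarrow>
     module.subspace (scl L) A \<and>
     A = {x + y | x y. x \<in> A \<inter> part L 0 \<and> y \<in> A \<inter> part L 1} \<and>
     (\<forall>x\<in>A. \<forall>y\<in>A. brac L x y \<in> A)"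

definition bilinear_form ::
  "('k::field, 'a::ab_group_add) superalg \<Rightarrow> ('a \<Rightarrow> 'a \<Rightarrow> 'k) \<Rightarrow> bool" where
  "bilinear_form L B \<longleftrightarrow> bilinear_between (scl L) (carr L) (*) UNIV B"

definition odd_form ::
  "('k::field, 'a::ab_group_add) superalg \<Rightarrow> ('a \<Rightarrow> 'a \<Rightarrow> 'k) \<Rightarrow> bool" where
  "odd_form L B \<longleftrightarrow> (\<forall>\<alpha>. \<forall>x\<in>part L \<alpha>. \<forall>y\<in>part L \<alpha>. B x y = 0)"

definition nondegenerate_form ::
  "('k::field, 'a::ab_group_add) superalg \<Rightarrow> ('a \<Rightarrow> 'a \<Rightarrow> 'k) \<Rightarrow> bool" where
  "nondegenerate_form L B \<longleftrightarrow>
     (\<forall>x\<in>carr L. (\<forall>y\<in>carr L. B x y = 0) \<longrightarrow> x = 0) \<and>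
     (\<forall>y\<in>carr L. (\<forall>x\<in>carr L. B x y = 0) \<longrightarrow> y = 0)"

definition odd_quadratic ::
  "('k::field, 'a::ab_group_add) superalg \<Rightarrow> ('a \<Rightarrow> 'a \<Rightarrow> 'k) \<Rightarrow> bool" where
  "odd_quadratic L B \<longleftrightarrow>
     bilinear_form L B \<and> odd_form L B \<and>
     (\<forall>\<alpha> \<beta>. \<forall>x\<in>part L \<alpha>. \<forall>y\<in>part L \<beta>. B x y = sgn2 (\<alpha> * \<beta>) * B y x) \<and>
     (\<forall>x\<in>carr L. \<forall>y\<in>carr L. \<forall>z\<in>carr L. B (brac L x y) z = B x (brac L y z)) \<and>
     nondegenerate_form L B"

definition odd_symplectic ::
  "('k::field, 'a::ab_group_add) superalg \<Rightarrow> ('a \<Rightarrow> 'a \<Rightarrow> 'k) \<Rightarrow> bool" where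
  "odd_symplectic L \<omega> \<longleftrightarrow>
     bilinear_form L \<omega> \<and> odd_form L \<omega> \<and>
     (\<forall>\<alpha> \<beta>. \<forall>x\<in>part L \<alpha>. \<forall>y\<in>part L \<beta>. \<omega> x y = - (sgn2 (\<alpha> * \<beta>) * \<omega> y x)) \<and>
     nondegenerate_form L \<omega> \<and>
     (\<forall>\<alpha> \<beta> \<gamma>. \<forall>x\<in>part L \<alpha>. \<forall>y\<in>part L \<beta>. \<forall>z\<in>part L \<gamma>.
        sgn2 (\<gamma> * \<alpha>) * \<omega> x (brac L y z) +
        sgn2 (\<alpha> * \<beta>) * \<omega> y (brac L z x) +
        sgn2 (\<beta> * \<gamma>) * \<omega> z (brac L x y) = 0)"

definition special_odd_symplectic_odd_manin ::
  "('k::field, 'a::ab_group_add) superalg \<Rightarrow> 'a set \<Rightarrow> 'a set \<Rightarrow>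
   ('a \<Rightarrow> 'a \<Rightarrow> 'k) \<Rightarrow> ('a \<Rightarrow> 'a \<Rightarrow> 'k) \<Rightarrow> bool" where
  "special_odd_symplectic_odd_manin L \<aa> \<bb> B \<omega> \<longleftrightarrow>
     lie_superalgebra L \<and>
     lie_subsuperalgebra L \<aa> \<and> lie_subsuperalgebra L \<bb> \<and>
     carr L = {x + y | x y. x \<in> \<aa> \<and> y \<in> \<bb>} \<and> \<aa> \<inter> \<bb> = {0} \<and>
     odd_quadratic L B \<and>
     (\<forall>x\<in>\<aa>. \<forall>y\<in>\<aa>. B x y = 0) \<and> (\<forall>x\<in>\<bb>. \<forall>y\<in>\<bb>. B x y = 0) \<and>
     odd_symplectic L \<omega> \<and>
     (\<forall>x\<in>\<aa>. \<forall>y\<in>\<aa>. \<omega> x y = 0) \<and> (\<forall>x\<in>\<bb>. \<forall>y\<in>\<bb>. \<omega> x y = 0)"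

definition superderivation ::
  "('k::field, 'a::ab_group_add) superalg \<Rightarrow> bit \<Rightarrow> ('a \<Rightarrow> 'a) \<Rightarrow> bool" where
  "superderivation L d \<Delta> \<longleftrightarrow>
     linear_between (scl L) (carr L) (scl L) (carr L) \<Delta> \<and>
     (\<forall>\<alpha>. \<Delta> ` part L \<alpha> \<subseteq> part L (\<alpha> + d)) \<and>
     (\<forall>\<alpha>. \<forall>x\<in>part L \<alpha>. \<forall>y\<in>carr L.
        \<Delta> (brac L x y) = brac L (\<Delta> x) y + scl L (sgn2 (d * \<alpha>)) (brac L x (\<Delta> y)))"

definition skew_supersymmetric ::
  "('k::field, 'a::ab_group_add) superalg \<Rightarrow> ('a \<Rightarrow> 'a \<Rightarrow> 'k) \<Rightarrow> bit \<Rightarrow> ('a \<Rightarrow> 'a) \<Rightarrow> bool" where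
  "skew_supersymmetric L B d \<Delta> \<longleftrightarrow>
     (\<forall>\<alpha>. \<forall>x\<in>part L \<alpha>. \<forall>y\<in>carr L. B (\<Delta> x) y = - (sgn2 (d * \<alpha>) * B x (\<Delta> y)))"

text \<open>The relation \<open>\<omega> = B(\<delta>\<cdot>,\<cdot>)\<close>; it determines \<open>\<delta>\<close> on \<open>carr L\<close>, as \<open>B\<close> is nondegenerate.\<close>

definition symplectic_derivation ::
  "('k::field, 'a::ab_group_add) superalg \<Rightarrow> ('a \<Rightarrow> 'a \<Rightarrow> 'k) \<Rightarrow> ('a \<Rightarrow> 'a \<Rightarrow> 'k) \<Rightarrow>
   ('a \<Rightarrow> 'a) \<Rightarrow> bool" where
  "symplectic_derivation L B \<omega> \<delta> \<longleftrightarrow>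
     superderivation L 0 \<delta> \<and> bij_betw \<delta> (carr L) (carr L) \<and>
     (\<forall>x\<in>carr L. \<forall>y\<in>carr L. \<omega> x y = B (\<delta> x) y)"

definition supercommutator ::
  "('k::field, 'a::ab_group_add) superalg \<Rightarrow> bit \<Rightarrow> ('a \<Rightarrow> 'a) \<Rightarrow> bit \<Rightarrow> ('a \<Rightarrow> 'a) \<Rightarrow> 'a \<Rightarrow> 'a" where
  "supercommutator L d f d' g x = f (g x) - scl L (sgn2 (d * d')) (g (f x))"

text \<open>The nonzero scalar usually denoted \<open>\<lambda>\<close> is written \<open>\<mu>\<close> here.\<close>

definition double_extension_data ::
  "('k::field, 'a::ab_group_add) superalg \<Rightarrow> ('a \<Rightarrow> 'a \<Rightarrow> 'k) \<Rightarrow> ('a \<Rightarrow> 'a \<Rightarrow> 'k) \<Rightarrow>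
   ('a \<Rightarrow> 'a) \<Rightarrow> ('a \<Rightarrow> 'a) \<Rightarrow> 'a \<Rightarrow> 'k \<Rightarrow> 'a \<Rightarrow> 'k \<Rightarrow> bool" where
  "double_extension_data H B \<omega> \<delta> D x\<^sub>0 k c\<^sub>1 \<mu> \<longleftrightarrow>
     lie_superalgebra H \<and> odd_quadratic H B \<and> odd_symplectic H \<omega> \<and>
     symplectic_derivation H B \<omega> \<delta> \<and>
     superderivation H 1 D \<and> skew_supersymmetric H B 1 D \<and>
     x\<^sub>0 \<in> part H 0 \<and> c\<^sub>1 \<in> part H 1 \<and> \<mu> \<noteq> 0 \<and>
     D x\<^sub>0 = 0 \<and>
     (\<forall>x\<in>carr H. D (D x) = scl H (1 / 2) (brac H x\<^sub>0 x)) \<and>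
     B c\<^sub>1 x\<^sub>0 = \<mu> * k \<and>
     scl H 2 (D c\<^sub>1) = \<delta> x\<^sub>0 + scl H (2 * \<mu>) x\<^sub>0 \<and>
     (\<forall>x\<in>carr H. supercommutator H 0 \<delta> 1 D x + scl H \<mu> (D x) = brac H c\<^sub>1 x)"

text \<open>
  An element \<open>s e\<^sup>* + X + t e\<close> of the double extension is represented by the triple \<open>(s, X, t)\<close>.
  Since \<open>[X, e] = -(-1)^{|X|} [e, X]\<close> for homogeneous \<open>X\<close>, bilinearity gives
  \<open>[X, e] = -[e, \<sigma> X]\<close> for all \<open>X\<close>, where \<open>\<sigma>\<close> is the parity automorphism.
\<close>

definition parity_aut :: "('k, 'a::ab_group_add) superalg \<Rightarrow> 'a \<Rightarrow> 'a" where
  "parity_aut H x = (THE y. \<exists>u\<in>part H 0. \<exists>v\<in>part H 1. x = u + v \<and> y = u - v)"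

definition double_extension ::
  "('k::field, 'a::ab_group_add) superalg \<Rightarrow> ('a \<Rightarrow> 'a \<Rightarrow> 'k) \<Rightarrow> ('a \<Rightarrow> 'a) \<Rightarrow> 'a \<Rightarrow> 'k \<Rightarrow>
   ('k, 'k \<times> 'a \<times> 'k) superalg" where
  "double_extension H B D x\<^sub>0 k =
    \<lparr> scl = (\<lambda>c (s, x, t). (c * s, scl H c x, c * t)),
      part = (\<lambda>\<alpha>. if \<alpha> = 0 then {(s, x, 0) | s x. x \<in> part H 0}
                  else {(0, x, t) | x t. x \<in> part H 1}),
      brac = (\<lambda>(s, x, t) (s', x', t').
        (B (D x) x' + t * B x\<^sub>0 x' - t' * B x\<^sub>0 (parity_aut H x) + t * t' * k,
         brac H x x' + scl H t (D x') - scl H t' (D (parity_aut H x)) + scl H (t * t') x\<^sub>0,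
         0)) \<rparr>"

definition double_extension_form ::
  "('a \<Rightarrow> 'a \<Rightarrow> 'k::field) \<Rightarrow> 'k \<times> 'a \<times> 'k \<Rightarrow> 'k \<times> 'a \<times> 'k \<Rightarrow> 'k" where
  "double_extension_form B = (\<lambda>(s, x, t) (s', x', t'). B x x' + s * t' + t * s')"

definition double_extension_derivation ::
  "('k::field, 'a::ab_group_add) superalg \<Rightarrow> ('a \<Rightarrow> 'a \<Rightarrow> 'k) \<Rightarrow> ('a \<Rightarrow> 'a) \<Rightarrow> 'a \<Rightarrow> 'k \<Rightarrow>
   'k \<times> 'a \<times> 'k \<Rightarrow> 'k \<times> 'a \<times> 'k" where
  "double_extension_derivation H B \<delta> c\<^sub>1 \<mu> =
     (\<lambda>(s, x, t). (\<mu> * s - B c\<^sub>1 x, \<delta> x + scl H t c\<^sub>1, - (\<mu> * t)))"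

definition double_extension_symplectic ::
  "('k::field, 'a::ab_group_add) superalg \<Rightarrow> ('a \<Rightarrow> 'a \<Rightarrow> 'k) \<Rightarrow> ('a \<Rightarrow> 'a) \<Rightarrow> 'a \<Rightarrow> 'k \<Rightarrow>
   'k \<times> 'a \<times> 'k \<Rightarrow> 'k \<times> 'a \<times> 'k \<Rightarrow> 'k" where
  "double_extension_symplectic H B \<delta> c\<^sub>1 \<mu> u v =
     double_extension_form B (double_extension_derivation H B \<delta> c\<^sub>1 \<mu> u) v"

definition isometric_isomorphism ::
  "('k::field, 'a::ab_group_add) superalg \<Rightarrow> ('a \<Rightarrow> 'a \<Rightarrow> 'k) \<Rightarrow> ('a \<Rightarrow> 'a \<Rightarrow> 'k) \<Rightarrow>
   ('k, 'b::ab_group_add) superalg \<Rightarrow> ('b \<Rightarrow> 'b \<Rightarrow> 'k) \<Rightarrow> ('b \<Rightarrow> 'b \<Rightarrow> 'k) \<Rightarrow>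
   ('a \<Rightarrow> 'b) \<Rightarrow> bool" where
  "isometric_isomorphism L B \<omega> L' B' \<omega>' \<phi> \<longleftrightarrow>
     linear_between (scl L) (carr L) (scl L') (carr L') \<phi> \<and>
     bij_betw \<phi> (carr L) (carr L') \<and>
     (\<forall>\<alpha>. \<phi> ` part L \<alpha> \<subseteq> part L' \<alpha>) \<and>
     (\<forall>x\<in>carr L. \<forall>y\<in>carr L. \<phi> (brac L x y) = brac L' (\<phi> x) (\<phi> y)) \<and>
     (\<forall>x\<in>carr L. \<forall>y\<in>carr L. B' (\<phi> x) (\<phi> y) = B x y) \<and>
     (\<forall>x\<in>carr L. \<forall>y\<in>carr L. \<omega>' (\<phi> x) (\<phi> y) = \<omega> x y)"

definition generalized_odd_double_extension_of ::
  "('k::field, 'a::ab_group_add) superalg \<Rightarrow> ('a \<Rightarrow> 'a \<Rightarrow> 'k) \<Rightarrow> ('a \<Rightarrow> 'a \<Rightarrow> 'k) \<Rightarrow>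
   ('k, 'b::ab_group_add) superalg \<Rightarrow> ('b \<Rightarrow> 'b \<Rightarrow> 'k) \<Rightarrow> ('b \<Rightarrow> 'b \<Rightarrow> 'k) \<Rightarrow> bool" where
  "generalized_odd_double_extension_of L B \<omega> H B\<^sub>H \<omega>\<^sub>H \<longleftrightarrow>
     (\<exists>\<delta> D x\<^sub>0 k c\<^sub>1 \<mu> \<phi>.
        double_extension_data H B\<^sub>H \<omega>\<^sub>H \<delta> D x\<^sub>0 k c\<^sub>1 \<mu> \<and>
        isometric_isomorphism L B \<omega>
          (double_extension H B\<^sub>H D x\<^sub>0 k)
          (double_extension_form B\<^sub>H)
          (double_extension_symplectic H B\<^sub>H \<delta> c\<^sub>1 \<mu>) \<phi>)"

end

theory Submission
  imports Defs
begin

text \<open>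
  Write \<open>\<omega> = B(\<delta> \<cdot>, \<cdot>)\<close>, where \<open>\<delta>\<close> is the even invertible superderivation, skew for \<open>B\<close>, that the
  two nondegenerate forms determine (\<open>symplectic_derivation_exists\<close>). The proof exploits the
  spectrum of \<open>\<delta>\<close>. Since the field is algebraically closed, the algebra is the sum of the
  generalized eigenspaces \<open>E\<^sub>\<lambda>\<close> of \<open>\<delta>\<close>. They satisfy \<open>[E\<^sub>\<lambda>, E\<^sub>\<mu>] \<subseteq> E\<^bsub>\<lambda>+\<mu>\<^esub>\<close>, and \<open>B(E\<^sub>\<lambda>, E\<^sub>\<mu>) = 0\<close>
  unless \<open>\<lambda> + \<mu> = 0\<close>; moreover \<open>0\<close> is not an eigenvalue.

  There is an even central eigenvector \<open>z\<close> of \<open>\<delta>\<close> (\<open>central_even_eigenvector\<close>). Bracketing with an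
  element of \<open>E\<^sub>\<lambda>\<close> shifts the finitely many eigenvalues by \<open>\<lambda> \<noteq> 0\<close>, so it is nilpotent; the
  Engel--Jacobson argument then shows that the Lie algebra \<open>\<gg>\<^sub>0\<close> has nonzero centre, on which \<open>\<delta>\<close>
  acts (\<open>center_nonzero\<close>). The odd form identifies \<open>\<gg>\<^sub>1\<close> with the dual of the \<open>\<gg>\<^sub>0\<close>-module \<open>\<gg>\<^sub>0\<close>, so what
  is central in \<open>\<gg>\<^sub>0\<close> is central in \<open>\<gg>\<close>.

  Such a \<open>z\<close> exhibits \<open>\<gg>\<close> as a double extension of \<open>z\<^sup>\<bottom> / \<K>z\<close>. With an odd \<open>e\<close> such that \<open>B(z, e) = 1\<close>,
  this quotient is realized on the subspace \<open>\<hh> = {z, e}\<^sup>\<bottom>\<close>, and the extension data are the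
  components in \<open>\<hh>\<close> of \<open>[e, \<cdot>]\<close>, \<open>[e, e]\<close> and \<open>\<delta>(e)\<close>
  (\<open>double_extension_data_H\<close>, \<open>coords_isometric_isomorphism\<close>).

  Finally \<open>\<hh>\<close> has a Manin decomposition, because every algebra with both kinds of forms has one
  (\<open>manin_decomposition_exists\<close>): choose a total order on the additive group of the field; the
  sum of the \<open>E\<^sub>\<lambda>\<close> with \<open>\<lambda> > 0\<close> and the sum of those with \<open>\<lambda> < 0\<close> are complementary subalgebras, each
  isotropic for \<open>B\<close> and for \<open>\<omega>\<close>, since two eigenvalues of the same sign never add up to \<open>0\<close>.
\<close>

section \<open>Generalized eigenspaces on a subspace\<close>

text \<open>
  The vectors of \<open>V\<close> killed by some product of factors \<open>f - l\<close> with \<open>l \<in> P\<close>: for a linear \<open>f\<close>, the sum of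
  the generalized eigenspaces for the eigenvalues in \<open>P\<close>. Allowing a set of eigenvalues makes the
  positive and the negative part of \<open>f\<close> instances of the same notion, and the inductive form turns
  most statements about them into an induction on the number of factors.
\<close>

inductive_set gen_eig ::
  "('k::field \<Rightarrow> 'a::ab_group_add \<Rightarrow> 'a) \<Rightarrow> 'a set \<Rightarrow> ('a \<Rightarrow> 'a) \<Rightarrow> 'k set \<Rightarrow> 'a set"
  for s V f P where
  gen_eig_zero: "0 \<in> gen_eig s V f P"
| gen_eig_step: "v \<in> V \<Longrightarrow> l \<in> P \<Longrightarrow> f v - s l v \<in> gen_eig s V f P \<Longrightarrow> v \<in> gen_eig s V f P"

lemma gen_eig_mono:
  assumes "P \<subseteq> Q" "v \<in> gen_eig s V f P"
  shows "v \<in> gen_eig s V f Q"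
  using assms(2) by (induction rule: gen_eig.induct) (use assms(1) in \<open>auto intro: gen_eig.intros\<close>)

lemma gen_eig_finite:
  assumes "v \<in> gen_eig s V f P"
  shows "\<exists>F. finite F \<and> F \<subseteq> P \<and> v \<in> gen_eig s V f F"
  using assms
proof (induction rule: gen_eig.induct)
  case gen_eig_zero
  then show ?case by (auto intro: gen_eig.intros)
next
  case (gen_eig_step v l)
  then obtain F where F: "finite F" "F \<subseteq> P" "f v - s l v \<in> gen_eig s V f F" by blast
  have "v \<in> gen_eig s V f (insert l F)"
    by (rule gen_eig.gen_eig_step[of _ _ l]) (use gen_eig_step.hyps gen_eig_mono[OF _ F(3), of "insert l F"] in auto)
  then show ?case using F gen_eig_step by (intro exI[of _ "insert l F"]) auto
qed

locale endomorphism_on = vector_space scale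
  for scale :: "'k::field \<Rightarrow> 'a::ab_group_add \<Rightarrow> 'a" (infixr \<open>*s\<close> 75) +
  fixes V :: "'a set" and f :: "'a \<Rightarrow> 'a"
  assumes subspace_V: "subspace V"
    and f_in: "x \<in> V \<Longrightarrow> f x \<in> V"
    and f_add: "x \<in> V \<Longrightarrow> y \<in> V \<Longrightarrow> f (x + y) = f x + f y"
    and f_scale: "x \<in> V \<Longrightarrow> f (c *s x) = c *s f x"
begin

abbreviation E :: "'k set \<Rightarrow> 'a set" where "E \<equiv> gen_eig scale V f"

abbreviation shift :: "'k \<Rightarrow> 'a \<Rightarrow> 'a" where "shift l v \<equiv> f v - l *s v"

lemmas V_add = subspace_add[OF subspace_V]
  and V_diff = subspace_diff[OF subspace_V]
  and V_scale = subspace_scale[OF subspace_V]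
  and V_zero = subspace_0[OF subspace_V]

lemma f_zero: "f 0 = 0"
  using f_scale[OF V_zero, of 0] by simp

lemma f_diff: "x \<in> V \<Longrightarrow> y \<in> V \<Longrightarrow> f (x - y) = f x - f y"
  using f_add[of "x - y" y] V_diff[of x y] by (simp add: algebra_simps)

lemma shift_in: "x \<in> V \<Longrightarrow> shift l x \<in> V"
  by (simp add: V_diff V_scale f_in)

lemma shift_add: "x \<in> V \<Longrightarrow> y \<in> V \<Longrightarrow> shift l (x + y) = shift l x + shift l y"
  by (simp add: f_add scale_right_distrib)

lemma shift_diff: "x \<in> V \<Longrightarrow> y \<in> V \<Longrightarrow> shift l (x - y) = shift l x - shift l y"
  by (simp add: f_diff scale_right_diff_distrib)

lemma shift_scale: "x \<in> V \<Longrightarrow> shift l (c *s x) = c *s shift l x"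
  by (simp add: f_scale scale_right_diff_distrib mult.commute)

lemma shift_commute: "x \<in> V \<Longrightarrow> shift l (shift m x) = shift m (shift l x)"
  by (simp add: f_diff f_scale f_in V_scale scale_right_diff_distrib mult.commute)

lemma gen_eig_subset: "E P \<subseteq> V"
  using V_zero by (auto elim: gen_eig.cases)

lemma gen_eig_scale: "x \<in> E P \<Longrightarrow> c *s x \<in> E P"
proof (induction rule: gen_eig.induct)
  case gen_eig_zero
  then show ?case by (simp add: gen_eig.intros)
next
  case (gen_eig_step v l)
  then have "shift l (c *s v) \<in> E P"
    by (simp only: shift_scale)
  then show ?case
    by (rule gen_eig.gen_eig_step[rotated 2]) (use gen_eig_step V_scale in auto)
qed

lemma gen_eig_shift: "x \<in> E P \<Longrightarrow> shift m x \<in> E P"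
proof (induction rule: gen_eig.induct)
  case gen_eig_zero
  then show ?case by (simp add: gen_eig.intros f_zero)
next
  case (gen_eig_step v l)
  then have "shift l (shift m v) \<in> E P"
    by (simp only: shift_commute[of v l m])
  then show ?case
    by (rule gen_eig.gen_eig_step[rotated 2]) (use gen_eig_step shift_in in auto)
qed

lemma gen_eig_add: "x \<in> E P \<Longrightarrow> y \<in> E P \<Longrightarrow> x + y \<in> E P"
proof (induction arbitrary: y rule: gen_eig.induct)
  case gen_eig_zero
  then show ?case by simp
next
  case (gen_eig_step v l)
  have yV: "y \<in> V" using gen_eig_step.prems gen_eig_subset by blast
  have "shift l (v + y) \<in> E P"
    unfolding shift_add[OF gen_eig_step.hyps(1) yV]
    by (rule gen_eig_step.IH[OF gen_eig_shift[OF gen_eig_step.prems]])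
  then show ?case
    by (rule gen_eig.gen_eig_step[rotated 2]) (use gen_eig_step yV V_add in auto)
qed

lemma subspace_gen_eig: "subspace (E P)"
  by (simp add: subspace_def gen_eig_add gen_eig_scale gen_eig_zero)

lemma gen_eig_f: "x \<in> E P \<Longrightarrow> f x \<in> E P"
  using gen_eig_shift[of x P 0] by simp

text \<open>
  On \<open>E Q\<close> the factor \<open>f - l\<close> equals \<open>f - m\<close> plus the nonzero scalar \<open>m - l\<close> for every \<open>m \<in> Q\<close>, and
  every vector is killed by a product of the \<open>f - m\<close>. Hence
  \<open>f - l\<close> is invertible there; this is the injective half.
\<close>

lemma shift_inj_on_gen_eig:
  assumes "x \<in> E Q" "l \<notin> Q" "shift l x = 0"
  shows "x = 0"
  using assms
proof (induction rule: gen_eig.induct)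
  case (gen_eig_step v m)
  have "shift l (shift m v) = shift m (shift l v)"
    using gen_eig_step by (intro shift_commute)
  also have "\<dots> = 0" using gen_eig_step by (simp add: f_zero)
  finally have "shift m v = 0" using gen_eig_step by blast
  then have "(m - l) *s v = 0"
    using gen_eig_step by (simp add: scale_left_diff_distrib)
  then show ?case using gen_eig_step by auto
qed simp

lemma shift_surj_on_gen_eig:
  assumes "b \<in> E Q" "l \<notin> Q"
  shows "\<exists>x \<in> E Q. shift l x = b"
  using assms
proof (induction rule: gen_eig.induct)
  case gen_eig_zero
  then show ?case using gen_eig.gen_eig_zero f_zero by (intro bexI[of _ 0]) auto
next
  case (gen_eig_step v m)
  \<comment> \<open>With \<open>(f - l) c = (f - m) v\<close> we get \<open>(f - l) (v - c) = (m - l) v\<close>, so \<open>v\<close> has a preimage.\<close>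
  then obtain c where c: "c \<in> E Q" "shift l c = shift m v" by blast
  have v: "v \<in> E Q" using gen_eig_step by (auto intro: gen_eig.intros)
  have cV: "c \<in> V" using c gen_eig_subset by blast
  let ?x = "(1 / (m - l)) *s (v - c)"
  have "m - l \<noteq> 0" using gen_eig_step by auto
  have "shift l (v - c) = (m - l) *s v"
    unfolding shift_diff[OF gen_eig_step.hyps(1) cV] c(2) by (simp add: scale_left_diff_distrib)
  then have "shift l ?x = v"
    unfolding shift_scale[OF V_diff[OF gen_eig_step.hyps(1) cV]]
    using \<open>m - l \<noteq> 0\<close> by (simp add: scale_left_diff_distrib[symmetric])
  moreover have "?x \<in> E Q"
    using v c by (intro gen_eig_scale subspace_diff[OF subspace_gen_eig])
  ultimately show ?case by blast
qed

lemma gen_eig_disjoint: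
  assumes "x \<in> E P" "x \<in> E Q" "P \<inter> Q = {}"
  shows "x = 0"
  using assms
proof (induction rule: gen_eig.induct)
  case (gen_eig_step v l)
  then have "shift l v = 0" using gen_eig_shift by blast
  then show ?case using shift_inj_on_gen_eig[of v Q l] gen_eig_step by blast
qed simp

lemma gen_eig_Un:
  assumes "x \<in> E (P \<union> Q)" "P \<inter> Q = {}"
  shows "\<exists>a \<in> E P. \<exists>b \<in> E Q. x = a + b"
  using assms
proof (induction rule: gen_eig.induct)
  case gen_eig_zero
  have "0 = 0 + (0::'a)" by simp
  then show ?case using gen_eig.gen_eig_zero by blast
next
  case (gen_eig_step v l)
  then obtain a b where ab: "a \<in> E P" "b \<in> E Q" "shift l v = a + b" by blast
  \<comment> \<open>Whichever of the two sets does not contain \<open>l\<close>: there \<open>f - l\<close> is invertible, so that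
    component can be lifted and subtracted off.\<close>
  have lift: "\<exists>c \<in> E R'. v - c \<in> E R"
    if "l \<in> R" and l: "l \<notin> R'" and "p \<in> E R" and q: "q \<in> E R'"
      and "shift l v = p + q" for R R' p q
  proof -
    obtain c where c: "c \<in> E R'" "shift l c = q"
      using shift_surj_on_gen_eig[OF q l] by blast
    have cV: "c \<in> V" using c gen_eig_subset by blast
    have "shift l (v - c) = p"
      unfolding shift_diff[OF gen_eig_step.hyps(1) cV] using c that by simp
    then have "v - c \<in> E R"
      using gen_eig.gen_eig_step[OF V_diff[OF gen_eig_step.hyps(1) cV] that(1), of f scale] that(3)
      by simp
    then show ?thesis using c by blast
  qed
  show ?case
  proof (cases "l \<in> P")
    case True
    then obtain c where "c \<in> E Q" "v - c \<in> E P"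
      using lift[of P Q a b] ab gen_eig_step.prems by blast
    then show ?thesis by (intro bexI[of _ "v - c"] bexI[of _ c]) simp_all
  next
    case False
    then obtain c where "c \<in> E P" "v - c \<in> E Q"
      using lift[of Q P b a] ab gen_eig_step.hyps(2) by (auto simp: add.commute)
    then show ?thesis by (intro bexI[of _ c] bexI[of _ "v - c"]) simp_all
  qed
qed


text \<open>
  Apply the factors \<open>f - l\<close> that kill \<open>v\<close> one after the other; the last vector outside \<open>W\<close> is an
  eigenvector modulo \<open>W\<close>.
\<close>

lemma exists_eigenvector_modulo:
  assumes "v \<in> E P" "v \<notin> W" "0 \<in> W"
  shows "\<exists>w l. w \<in> E P \<and> l \<in> P \<and> w \<notin> W \<and> shift l w \<in> W"
  using assms
proof (induction rule: gen_eig.induct)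
  case (gen_eig_step v l)
  show ?case
  proof (cases "shift l v \<in> W")
    case True
    then show ?thesis using gen_eig_step gen_eig.gen_eig_step[of v V l P] by blast
  qed (use gen_eig_step in blast)
qed simp

lemma gen_eig_subset_if_singletons:
  assumes W: "subspace W" and single: "\<And>l. l \<in> P \<Longrightarrow> E {l} \<subseteq> W"
  shows "E P \<subseteq> W"
proof
  fix x assume "x \<in> E P"
  then obtain F where F: "finite F" "F \<subseteq> P" "x \<in> E F" using gen_eig_finite by metis
  have "F \<subseteq> P \<Longrightarrow> E F \<subseteq> W" using F(1)
  proof (induction F)
    case empty
    then show ?case using subspace_0[OF W] by (auto elim: gen_eig.cases)
  next
    case (insert l F)
    show ?case
    proof
      fix y assume "y \<in> E (insert l F)"
      then have "y \<in> E ({l} \<union> F)" by simp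
      then obtain a b where "a \<in> E {l}" "b \<in> E F" "y = a + b"
        using gen_eig_Un[of y "{l}" F] insert by auto
      then show "y \<in> W" using insert single subspace_add[OF W] by blast
    qed
  qed
  then show "x \<in> W" using F by blast
qed

lemma funpow_in: "x \<in> V \<Longrightarrow> (f ^^ i) x \<in> V"
  by (induction i) (auto simp: f_in)

lemma funpow_shift: "x \<in> V \<Longrightarrow> (f ^^ i) (shift l x) = (f ^^ Suc i) x - l *s (f ^^ i) x"
  by (induction i) (auto simp: f_in f_diff f_scale funpow_in V_scale)

definition poly_apply :: "'k poly \<Rightarrow> 'a \<Rightarrow> 'a" where
  "poly_apply p v = (\<Sum>i\<le>degree p. coeff p i *s (f ^^ i) v)"

lemma poly_apply_upto:
  assumes "degree p \<le> n"
  shows "poly_apply p v = (\<Sum>i\<le>n. coeff p i *s (f ^^ i) v)"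
  unfolding poly_apply_def
  by (rule sum.mono_neutral_left) (use assms in \<open>auto simp: coeff_eq_0\<close>)

lemma poly_apply_linear_factor:
  assumes "v \<in> V"
  shows "poly_apply ([:- l, 1:] * q) v = poly_apply q (shift l v)"
proof -
  have eq: "[:- l, 1:] * q = pCons 0 q - Polynomial.smult l q" by simp
  have "degree ([:- l, 1:] * q) \<le> Suc (degree q)"
    using degree_mult_le[of "[:- l, 1:]" q] by simp
  then have "poly_apply ([:- l, 1:] * q) v
      = (\<Sum>i\<le>Suc (degree q). (coeff (pCons 0 q) i - l * coeff q i) *s (f ^^ i) v)"
    by (subst poly_apply_upto) (auto simp: eq)
  also have "\<dots> = (\<Sum>i\<le>Suc (degree q). coeff (pCons 0 q) i *s (f ^^ i) v)
      - (\<Sum>i\<le>Suc (degree q). (l * coeff q i) *s (f ^^ i) v)"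
    by (simp add: scale_left_diff_distrib sum_subtractf)
  also have "(\<Sum>i\<le>Suc (degree q). coeff (pCons 0 q) i *s (f ^^ i) v)
      = (\<Sum>i\<le>degree q. coeff q i *s (f ^^ Suc i) v)"
    by (subst sum.atMost_Suc_shift) simp
  also have "(\<Sum>i\<le>Suc (degree q). (l * coeff q i) *s (f ^^ i) v)
      = (\<Sum>i\<le>degree q. (l * coeff q i) *s (f ^^ i) v)"
    by (simp add: coeff_eq_0)
  also have "(\<Sum>i\<le>degree q. coeff q i *s (f ^^ Suc i) v)
      - (\<Sum>i\<le>degree q. (l * coeff q i) *s (f ^^ i) v)
      = (\<Sum>i\<le>degree q. coeff q i *s ((f ^^ Suc i) v - l *s (f ^^ i) v))"
    by (simp add: sum_subtractf scale_right_diff_distrib mult.commute)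
  also have "\<dots> = poly_apply q (shift l v)"
    unfolding poly_apply_def using funpow_shift[OF assms] by simp
  finally show ?thesis .
qed

text \<open>
  One more iterate \<open>f\<^sup>i v\<close> than the dimension bound are linearly dependent, or two of them coincide;
  either way the relation gives the coefficients of a polynomial.
\<close>

lemma annihilating_poly:
  assumes "v \<in> V" "finite S" "V \<subseteq> span S"
  shows "\<exists>p. p \<noteq> 0 \<and> poly_apply p v = 0"
proof -
  let ?w = "\<lambda>i. (f ^^ i) v" and ?n = "card S"
  have w: "?w ` {..?n} \<subseteq> span S" using funpow_in[OF assms(1)] assms(3) by blast
  have "\<exists>c. (\<exists>i\<le>?n. c i \<noteq> 0) \<and> (\<Sum>i\<le>?n. c i *s ?w i) = 0"
  proof (cases "inj_on ?w {..?n}")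
    case True
    have "dependent (?w ` {..?n})"
    proof (rule ccontr)
      assume "\<not> dependent (?w ` {..?n})"
      then have "card (?w ` {..?n}) \<le> ?n"
        using independent_span_bound[OF assms(2) _ w] by blast
      then show False using card_image[OF True] by simp
    qed
    then have "\<exists>u. (\<exists>x\<in>?w ` {..?n}. u x \<noteq> 0) \<and> (\<Sum>x\<in>?w ` {..?n}. u x *s x) = 0"
      by (rule iffD1[OF dependent_finite, rotated]) simp
    then obtain u x where "x \<in> ?w ` {..?n}" and ux: "u x \<noteq> 0"
      and u0: "(\<Sum>x\<in>?w ` {..?n}. u x *s x) = 0"
      by (elim exE conjE bexE)
    then obtain i where u: "i \<le> ?n" "u (?w i) \<noteq> 0" by (elim imageE) simp
    then have "(\<Sum>i\<le>?n. u (?w i) *s ?w i) = 0"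
      using u0 unfolding sum.reindex[OF True] by (simp only: o_def)
    then show ?thesis using u by (intro exI[of _ "\<lambda>i. u (?w i)"]) auto
  next
    case False
    then obtain i j where ij: "i \<le> ?n" "j \<le> ?n" "i \<noteq> j" "?w i = ?w j" by (auto simp: inj_on_def)
    let ?c = "\<lambda>k. (if k = i then 1 else 0) - (if k = j then 1 else 0)"
    have "(\<Sum>k\<le>?n. ?c k *s ?w k)
        = (\<Sum>k\<le>?n. if k = i then ?w k else 0) - (\<Sum>k\<le>?n. if k = j then ?w k else 0)"
      unfolding sum_subtractf[symmetric] by (rule sum.cong) auto
    also have "\<dots> = 0" using ij by (simp add: sum.delta')
    finally show ?thesis using ij by (intro exI[of _ ?c]) auto
  qed
  then obtain c i where c: "i \<le> ?n" "c i \<noteq> 0" "(\<Sum>i\<le>?n. c i *s ?w i) = 0"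
    by (elim exE conjE)
  define p where "p = Abs_poly (\<lambda>i. if i \<le> ?n then c i else 0)"
  have cp: "coeff p = (\<lambda>i. if i \<le> ?n then c i else 0)"
    unfolding p_def by (rule Abs_poly_inverse) (auto simp: MOST_nat intro: exI[of _ ?n])
  have "coeff p i \<noteq> 0" using c(1,2) by (simp add: cp)
  then have "p \<noteq> 0" by auto
  have "degree p \<le> ?n" by (rule degree_le) (simp add: cp)
  then have "poly_apply p v = (\<Sum>i\<le>?n. coeff p i *s ?w i)" by (rule poly_apply_upto)
  also have "\<dots> = 0" using c(3) by (simp add: cp)
  finally show ?thesis using \<open>p \<noteq> 0\<close> by blast
qed

end

locale closed_endomorphism_on = endomorphism_on scale V f
  for scale :: "'k::alg_closed_field \<Rightarrow> 'a::ab_group_add \<Rightarrow> 'a" (infixr \<open>*s\<close> 75) and V f +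
  assumes finite_dim_V: "\<exists>S. finite S \<and> V \<subseteq> span S"
begin

lemma gen_eig_if_annihilated: 
  assumes "p \<noteq> 0" "v \<in> V" "poly_apply p v = 0"
  shows "v \<in> E UNIV"
  using assms
proof (induction "degree p" arbitrary: p v)
  case 0
  then have "coeff p 0 \<noteq> 0" by (metis leading_coeff_0_iff)
  moreover have "coeff p 0 *s v = 0" using 0 by (simp add: poly_apply_def)
  ultimately have "v = 0" by simp
  then show ?case by (simp add: gen_eig_zero)
next
  case (Suc n)
  then obtain l where "poly p l = 0" using alg_closed_imp_poly_has_root[of p] by auto
  then obtain q where q: "p = [:- l, 1:] * q" using poly_eq_0_iff_dvd by blast
  have "q \<noteq> 0" using q Suc by auto
  then have "degree p = Suc (degree q)" unfolding q by (subst degree_mult_eq) auto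
  then have "shift l v \<in> E UNIV"
    using Suc q \<open>q \<noteq> 0\<close> shift_in poly_apply_linear_factor[of v l q] by (intro Suc.hyps(1)[of q]) auto
  then show ?case using gen_eig_step[of v V l UNIV] Suc by simp
qed

lemma gen_eig_UNIV: "E UNIV = V"
proof
  show "V \<subseteq> E UNIV"
  proof
    fix v assume "v \<in> V"
    then show "v \<in> E UNIV"
      using annihilating_poly[of v] gen_eig_if_annihilated[of _ v] finite_dim_V by auto
  qed
qed (rule gen_eig_subset)

lemma finite_spectrum: "\<exists>F. finite F \<and> V \<subseteq> E F"
proof -
  obtain S where S: "finite S" "V \<subseteq> span S" using finite_dim_V by blast
  obtain T where T: "T \<subseteq> V" "independent T" "V \<subseteq> span T" using maximal_independent_subset by blast
  have "finite T" using independent_span_bound[OF S(1) T(2)] T S by blast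
  have "\<forall>t\<in>T. \<exists>F. finite F \<and> t \<in> E F"
  proof
    fix t assume "t \<in> T"
    then have "t \<in> E UNIV" using T(1) gen_eig_UNIV by auto
    then show "\<exists>F. finite F \<and> t \<in> E F" by (blast dest: gen_eig_finite[of t scale V f UNIV])
  qed
  then obtain F where F: "\<forall>t\<in>T. finite (F t) \<and> t \<in> E (F t)"
    unfolding bchoice_iff by (elim exE)
  have "T \<subseteq> E (\<Union>t\<in>T. F t)" 
  proof
    fix t assume t: "t \<in> T"
    show "t \<in> E (\<Union>t\<in>T. F t)"
      by (rule gen_eig_mono[of "F t"]) (use F t in auto)
  qed
  then have "V \<subseteq> E (\<Union>t\<in>T. F t)"
    by (intro subset_trans[OF T(3)] span_minimal subspace_gen_eig)
  then show ?thesis using F \<open>finite T\<close> by (intro exI[of _ "\<Union>t\<in>T. F t"]) simp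
qed

end

section \<open>Total orders on the additive group of a field of characteristic zero\<close>

text \<open>
  The cone \<open>P\<close> of positive elements of a total order compatible with addition. A cone that is
  maximal among those avoiding \<open>0\<close> is total: if neither \<open>x\<close> nor \<open>- x\<close> could be adjoined, positive
  multiples of both \<open>x\<close> and \<open>- x\<close> would lie in it, and so would \<open>0\<close>.
\<close>

lemma total_cone_exists:
  "\<exists>P :: 'k::field_char_0 set. 0 \<notin> P \<and> (\<forall>x\<in>P. \<forall>y\<in>P. x + y \<in> P) \<and> (\<forall>x. x \<noteq> 0 \<longrightarrow> x \<in> P \<or> - x \<in> P)"
proof -
  define \<A> :: "'k set set" where "\<A> = {P. 0 \<notin> P \<and> (\<forall>x\<in>P. \<forall>y\<in>P. x + y \<in> P)}"
  have "\<exists>M\<in>\<A>. \<forall>X\<in>\<A>. M \<subseteq> X \<longrightarrow> X = M"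
  proof (rule subset_Zorn')
    fix C assume C: "subset.chain \<A> C"
    then have sub: "C \<subseteq> \<A>" and tot: "\<And>X Y. X \<in> C \<Longrightarrow> Y \<in> C \<Longrightarrow> X \<subseteq> Y \<or> Y \<subseteq> X"
      unfolding subset_chain_def by blast+
    have "x + y \<in> \<Union>C" if xy: "x \<in> \<Union>C" "y \<in> \<Union>C" for x y
    proof -
      obtain X Y where XY: "x \<in> X" "X \<in> C" "y \<in> Y" "Y \<in> C" using xy by (elim UnionE)
      then obtain Z where "Z \<in> C" "x \<in> Z" "y \<in> Z" using tot[of X Y] by auto
      then show ?thesis using sub unfolding \<A>_def by auto
    qed
    moreover have "0 \<notin> \<Union>C" using sub unfolding \<A>_def by auto
    ultimately show "\<Union>C \<in> \<A>" unfolding \<A>_def by auto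
  qed
  then obtain M where M: "M \<in> \<A>" and max: "\<And>X. X \<in> \<A> \<Longrightarrow> M \<subseteq> X \<Longrightarrow> X = M" by auto
  have M0: "0 \<notin> M" and Madd: "\<And>x y. x \<in> M \<Longrightarrow> y \<in> M \<Longrightarrow> x + y \<in> M"
    using M unfolding \<A>_def by auto
  have Mmult: "of_nat (Suc n) * x \<in> M" if "x \<in> M" for n x
  proof (induction n)
    case (Suc n)
    have "of_nat (Suc (Suc n)) * x = x + of_nat (Suc n) * x" by (simp add: algebra_simps)
    then show ?case using Madd[OF that Suc] by simp
  qed (simp add: that)
  have step: "\<exists>n. - (of_nat (Suc n) * x) \<in> M" if x: "x \<noteq> 0" "x \<notin> M" for x
  proof -
    let ?N = "M \<union> {p + of_nat (Suc n) * x | p n. p \<in> insert 0 M}"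
    have "u + v \<in> ?N" if u: "u \<in> ?N" and v: "v \<in> ?N" for u v
    proof -
      \<comment> \<open>Every element of the enlarged set is a combination with a multiplicity that may be 0.\<close>
      have form: "\<exists>p n. w = p + of_nat n * x \<and> p \<in> insert 0 M \<and> (n = 0 \<longrightarrow> p \<in> M)"
        if "w \<in> ?N" for w
        using that
      proof
        assume "w \<in> M"
        then show ?thesis by (intro exI[of _ w] exI[of _ 0]) auto
      next
        assume "w \<in> {p + of_nat (Suc n) * x | p n. p \<in> insert 0 M}"
        then obtain p n where "w = p + of_nat (Suc n) * x" "p \<in> insert 0 M" by blast
        then show ?thesis by (intro exI[of _ p] exI[of _ "Suc n"]) auto
      qed
      obtain p n where u: "u = p + of_nat n * x" "p \<in> insert 0 M" "n = 0 \<longrightarrow> p \<in> M"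
        using form[OF u] by auto
      obtain q m where v: "v = q + of_nat m * x" "q \<in> insert 0 M" "m = 0 \<longrightarrow> q \<in> M"
        using form[OF v] by auto
      have sum: "u + v = (p + q) + of_nat (n + m) * x" using u v by (simp add: algebra_simps)
      have pq: "p + q \<in> insert 0 M" using u v Madd by auto
      show ?thesis
      proof (cases "n + m")
        case 0
        then show ?thesis using u v Madd by simp
      next
        case (Suc j)
        then show ?thesis using sum pq by (intro UnI2 CollectI exI[of _ "p + q"] exI[of _ j]) simp
      qed
    qed
    moreover have "x \<in> ?N"
      by (intro UnI2 CollectI exI[of _ 0]) auto
    then have "?N \<noteq> M" using x by metis
    ultimately have "0 \<in> ?N" using max[of ?N] unfolding \<A>_def by blast
    then obtain p n where "0 = p + of_nat (Suc n) * x" and p: "p \<in> insert 0 M" using M0 by blast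
    then have eq: "p = - (of_nat (Suc n) * x)" by (simp only: eq_neg_iff_add_eq_0)
    have "(of_nat (Suc n) :: 'k) \<noteq> 0" by (rule of_nat_neq_0)
    then have "p \<noteq> 0" using eq x(1) by simp
    then show ?thesis using p unfolding eq by (intro exI[of _ n]) simp
  qed
  have "x \<in> M \<or> - x \<in> M" if "x \<noteq> 0" for x
  proof (rule ccontr)
    assume no: "\<not> (x \<in> M \<or> - x \<in> M)"
    then have "x \<notin> M" "- x \<noteq> 0" "- x \<notin> M" using that by simp_all
    obtain n where n: "- (of_nat (Suc n) * x) \<in> M"
      using step[OF \<open>x \<noteq> 0\<close> \<open>x \<notin> M\<close>] by (rule exE)
    obtain m where "- (of_nat (Suc m) * (- x)) \<in> M"
      using step[OF \<open>- x \<noteq> 0\<close> \<open>- x \<notin> M\<close>] by (rule exE)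
    then have m: "of_nat (Suc m) * x \<in> M" by (simp only: mult_minus_right minus_minus)
    have "of_nat (Suc m) * (- (of_nat (Suc n) * x)) + of_nat (Suc n) * (of_nat (Suc m) * x) \<in> M"
      by (intro Madd Mmult n m)
    then show False using M0 by (simp only: mult_minus_right mult.left_commute[of "of_nat (Suc m)"])
        simp
  qed
  then show ?thesis using M0 Madd by blast
qed

section \<open>Lie algebras with an injective derivation have nonzero centre\<close>

locale derivation_on = endomorphism_on scale V f
  for scale :: "'k::field \<Rightarrow> 'a::ab_group_add \<Rightarrow> 'a" (infixr \<open>*s\<close> 75) and V f +
  fixes br :: "'a \<Rightarrow> 'a \<Rightarrow> 'a"
  assumes br_in: "x \<in> V \<Longrightarrow> y \<in> V \<Longrightarrow> br x y \<in> V"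
    and br_add_left: "x \<in> V \<Longrightarrow> y \<in> V \<Longrightarrow> z \<in> V \<Longrightarrow> br (x + y) z = br x z + br y z"
    and br_add_right: "x \<in> V \<Longrightarrow> y \<in> V \<Longrightarrow> z \<in> V \<Longrightarrow> br x (y + z) = br x y + br x z"
    and br_scale_left: "x \<in> V \<Longrightarrow> y \<in> V \<Longrightarrow> br (c *s x) y = c *s br x y"
    and br_scale_right: "x \<in> V \<Longrightarrow> y \<in> V \<Longrightarrow> br x (c *s y) = c *s br x y"
    and derivation: "x \<in> V \<Longrightarrow> y \<in> V \<Longrightarrow> f (br x y) = br (f x) y + br x (f y)"
begin

lemma br_zero_left: "y \<in> V \<Longrightarrow> br 0 y = 0"
  using br_scale_left[OF V_zero, of y 0] by simp

lemma br_zero_right: "x \<in> V \<Longrightarrow> br x 0 = 0"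
  using br_scale_right[OF _ V_zero, of x 0] by simp

lemma br_diff_left: "x \<in> V \<Longrightarrow> y \<in> V \<Longrightarrow> z \<in> V \<Longrightarrow> br (x - y) z = br x z - br y z"
  using br_add_left[of "x - y" y z] V_diff[of x y] by (simp add: algebra_simps)

lemma br_diff_right: "x \<in> V \<Longrightarrow> y \<in> V \<Longrightarrow> z \<in> V \<Longrightarrow> br x (y - z) = br x y - br x z"
  using br_add_right[of x "y - z" z] V_diff[of y z] by (simp add: algebra_simps)

lemma shift_br:
  assumes "x \<in> V" "y \<in> V"
  shows "shift (l + m) (br x y) = br (shift l x) y + br x (shift m y)"
  unfolding br_diff_left[OF f_in[OF assms(1)] V_scale[OF assms(1)] assms(2)]
    br_diff_right[OF assms(1) f_in[OF assms(2)] V_scale[OF assms(2)]]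
    br_scale_left[OF assms] br_scale_right[OF assms] derivation[OF assms] scale_left_distrib
  by simp

text \<open>
  By the Leibniz rule \<open>(f - l - m)[x, y] = [(f - l) x, y] + [x, (f - m) y]\<close>, and each summand on the right
  needs one factor less.
\<close>

lemma gen_eig_br:
  assumes "x \<in> E P" "y \<in> E Q"
  shows "br x y \<in> E {p + q | p q. p \<in> P \<and> q \<in> Q}"
  using assms
proof (induction arbitrary: y rule: gen_eig.induct)
  case gen_eig_zero
  then show ?case using br_zero_left[of y] gen_eig_subset[of Q] by (auto simp: gen_eig.gen_eig_zero)
next
  case outer: (gen_eig_step x l)
  show ?case using outer.prems
  proof (induction rule: gen_eig.induct)
    case gen_eig_zero
    then show ?case using outer.hyps by (simp add: br_zero_right gen_eig.gen_eig_zero)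
  next
    case (gen_eig_step y m)
    have y: "y \<in> E Q" by (rule gen_eig.gen_eig_step[OF gen_eig_step.hyps])
    have "shift (l + m) (br x y) \<in> E {p + q | p q. p \<in> P \<and> q \<in> Q}"
      unfolding shift_br[OF outer.hyps(1) gen_eig_step.hyps(1)]
      by (rule gen_eig_add[OF outer.IH[OF y] gen_eig_step.IH])
    moreover have "br x y \<in> V" using outer gen_eig_step by (simp add: br_in)
    moreover have "l + m \<in> {p + q | p q. p \<in> P \<and> q \<in> Q}" using outer gen_eig_step by blast
    ultimately show ?case by (rule gen_eig.gen_eig_step[rotated 2])
  qed
qed

end

locale lie_derivation = derivation_on scale V f br + closed_endomorphism_on scale V f
  for scale :: "'k::{alg_closed_field, field_char_0} \<Rightarrow> 'a::ab_group_add \<Rightarrow> 'a" (infixr \<open>*s\<close> 75)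
    and V f br +
  assumes br_self: "x \<in> V \<Longrightarrow> br x x = 0"
    and jacobi: "x \<in> V \<Longrightarrow> y \<in> V \<Longrightarrow> z \<in> V \<Longrightarrow> br x (br y z) = br (br x y) z + br y (br x z)"
    and f_inj: "x \<in> V \<Longrightarrow> f x = 0 \<Longrightarrow> x = 0"
begin

text \<open>
  The ascending series of the action of \<open>M\<close> on \<open>V\<close>: \<open>upper M n\<close> consists of the vectors killed by all
  products of \<open>n\<close> operators \<open>br x\<close> with \<open>x \<in> M\<close>, so \<open>nil M\<close> below says that \<open>M\<close> acts jointly nilpotently.
  Its terms inherit from \<open>M\<close> the stability under \<open>f\<close>, and they are stable under the normalizer of \<open>M\<close>.
\<close>

primrec upper :: "'a set \<Rightarrow> nat \<Rightarrow> 'a set" where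
  "upper M 0 = {0}"
| "upper M (Suc i) = {v \<in> V. \<forall>x\<in>M. br x v \<in> upper M i}"

definition nil :: "'a set \<Rightarrow> bool" where
  "nil M \<longleftrightarrow> (\<exists>n. V \<subseteq> upper M n)"

lemma br_anti: "x \<in> V \<Longrightarrow> y \<in> V \<Longrightarrow> br x y = - br y x"
proof -
  assume xy: "x \<in> V" "y \<in> V"
  have "br (x + y) (x + y) = br x x + br y x + (br x y + br y y)"
    using xy by (simp only: br_add_left br_add_right V_add)
  then have "br y x + br x y = 0"
    using xy by (simp add: br_self V_add)
  then show ?thesis by (simp add: eq_neg_iff_add_eq_0 add.commute)
qed

lemma upper_subset: "upper M i \<subseteq> V"
  using V_zero by (cases i) auto

lemma subspace_upper: "M \<subseteq> V \<Longrightarrow> subspace (upper M i)"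
proof (induction i)
  case (Suc i)
  have "0 \<in> upper M (Suc i)"
    using Suc subspace_0[of "upper M i"] V_zero by (auto simp: br_zero_right)
  moreover have "x + y \<in> upper M (Suc i)" if "x \<in> upper M (Suc i)" "y \<in> upper M (Suc i)" for x y
    using that Suc by (auto simp: V_add br_add_right subset_iff intro!: subspace_add[of "upper M i"])
  moreover have "c *s x \<in> upper M (Suc i)" if "x \<in> upper M (Suc i)" for c x
    using that Suc by (auto simp: V_scale br_scale_right subset_iff intro!: subspace_scale[of "upper M i"])
  ultimately show ?case by (auto simp: subspace_def)
qed simp

lemma upper_mono:
  assumes "M \<subseteq> V" "i \<le> j"
  shows "upper M i \<subseteq> upper M j"
proof -
  have "upper M n \<subseteq> upper M (Suc n)" for n
    using assms(1) by (induction n) (auto simp: V_zero br_zero_right subset_iff)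
  then show ?thesis using lift_Suc_mono_le[of "upper M"] assms(2) by blast
qed

lemma normalizer_upper:
  assumes "M \<subseteq> V" "s \<in> V" "\<And>x. x \<in> M \<Longrightarrow> br s x \<in> M" "v \<in> upper M i"
  shows "br s v \<in> upper M i"
  using assms(4)
proof (induction i arbitrary: v)
  case 0
  then show ?case using br_zero_right assms by simp
next
  case (Suc i)
  then have v: "v \<in> V" by simp
  have "br x (br s v) \<in> upper M i" if x: "x \<in> M" for x
  proof -
    have xV: "x \<in> V" using x assms by blast
    have "br s (br x v) = br (br s x) v + br x (br s v)" using jacobi assms xV v by blast
    then have "br x (br s v) = br s (br x v) - br (br s x) v" by simp
    moreover have "br s (br x v) \<in> upper M i" "br (br s x) v \<in> upper M i"
      using Suc x assms(3) by auto
    ultimately show ?thesis using subspace_diff[OF subspace_upper[OF assms(1)]] by metis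
  qed
  then show ?case using assms(2) v br_in by simp
qed

lemma f_upper:
  assumes "M \<subseteq> V" "\<And>x. x \<in> M \<Longrightarrow> f x \<in> M" "v \<in> upper M i"
  shows "f v \<in> upper M i"
  using assms(3)
proof (induction i arbitrary: v)
  case 0
  then show ?case using f_zero by simp
next
  case (Suc i)
  then have v: "v \<in> V" by simp
  have "br x (f v) \<in> upper M i" if x: "x \<in> M" for x
  proof -
    have xV: "x \<in> V" using x assms by blast
    have "br x (f v) = f (br x v) - br (f x) v" using derivation[OF xV v] by simp
    moreover have "f (br x v) \<in> upper M i" "br (f x) v \<in> upper M i"
      using Suc x assms(2) by auto
    ultimately show ?thesis using subspace_diff[OF subspace_upper[OF assms(1)]] by metis
  qed
  then show ?case using f_in v by simp
qed

text \<open>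
  \<open>(br s)\<^sup>n\<close> moves every eigenvalue by \<open>n l\<close>. For \<open>n\<close> large enough the shifted spectrum misses the
  spectrum, since in characteristic zero the multiples of \<open>l \<noteq> 0\<close> are distinct.
\<close>

lemma ad_nilpotent:
  assumes s: "s \<in> E {l}" and l: "l \<noteq> 0"
  shows "\<exists>n. \<forall>v\<in>V. (br s ^^ n) v = 0"
proof -
  obtain F where F: "finite F" "V \<subseteq> E F" using finite_spectrum by blast
  have pow: "(br s ^^ n) v \<in> E {of_nat n * l + q | q. q \<in> F}" if "v \<in> V" for n v
  proof (induction n)
    case 0
    then show ?case using F that by auto
  next
    case (Suc n)
    have "{p + q | p q. p \<in> {l} \<and> q \<in> {of_nat n * l + q | q. q \<in> F}}
        \<subseteq> {of_nat (Suc n) * l + q | q. q \<in> F}"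
      by (auto simp: algebra_simps)
    then show ?case using gen_eig_br[OF s Suc] gen_eig_mono by auto
  qed
  have "finite (\<Union>q\<in>F. \<Union>q'\<in>F. {n::nat. of_nat n * l + q = q'})"
  proof (intro finite_UN_I F(1))
    fix q q'
    have "n = m" if "of_nat n * l + q = q'" "of_nat m * l + q = q'" for n m :: nat
    proof -
      have "of_nat n * l = of_nat m * l" using that by (metis add_right_cancel)
      then show ?thesis using l by simp
    qed
    then have "\<exists>n. {n::nat. of_nat n * l + q = q'} \<subseteq> {n}" by blast
    then show "finite {n::nat. of_nat n * l + q = q'}" using finite_subset by blast
  qed
  then obtain n where n: "n \<notin> (\<Union>q\<in>F. \<Union>q'\<in>F. {n::nat. of_nat n * l + q = q'})"
    using ex_new_if_finite[OF infinite_UNIV_nat] by blast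
  then have "{of_nat n * l + q | q. q \<in> F} \<inter> F = {}" by auto
  moreover have "(br s ^^ n) v \<in> E F" if "v \<in> V" for v
  proof -
    have "s \<in> V" using s gen_eig_subset by blast
    then have "(br s ^^ n) v \<in> V" by (induction n) (auto simp: that br_in)
    then show ?thesis using F by blast
  qed
  ultimately show ?thesis using pow gen_eig_disjoint by blast
qed

text \<open>
  In a product of operators \<open>br x\<close> with \<open>x \<in> M + \<K>s\<close>, a factor from \<open>M\<close> can be moved past \<open>br s\<close> at the
  cost of another factor from \<open>M\<close>. So a long product either has many factors from \<open>M\<close> or contains
  \<open>p\<close> successive factors \<open>br s\<close>, and vanishes in both cases.
\<close>

lemma nil_extend:
  assumes M: "subspace M" "M \<subseteq> V" "nil M"
    and s: "s \<in> V" "\<And>x. x \<in> M \<Longrightarrow> br s x \<in> M"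
    and p: "\<And>v. v \<in> V \<Longrightarrow> (br s ^^ p) v = 0"
    and M': "\<And>x. x \<in> M' \<Longrightarrow> \<exists>y\<in>M. \<exists>c. x = y + c *s s" "M' \<subseteq> V"
  shows "nil M'"
proof -
  have "upper M i \<subseteq> upper M' (i * p)" for i
  proof (induction i)
    case (Suc i)
    \<comment> \<open>On \<open>upper M (Suc i)\<close> an element of \<open>M\<close> drops one level, and \<open>br s\<close> stays on the level but
      can be applied at most \<open>p\<close> times.\<close>
    have "(br s ^^ (p - j)) v \<in> upper M' (i * p + j)" if v: "v \<in> upper M (Suc i)" and "j \<le> p" for v j
      using that(2)
    proof (induction j)
      case 0
      have "v \<in> V" using v by simp
      then show ?case using p subspace_0[OF subspace_upper[OF M'(2)]] by simp
    next
      case (Suc j)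
      let ?w = "(br s ^^ (p - Suc j)) v"
      have w: "?w \<in> upper M (Suc i)"
      proof -
        have "(br s ^^ k) v \<in> upper M (Suc i)" for k
          by (induction k) (use v normalizer_upper[OF M(2) s] in \<open>simp_all del: upper.simps\<close>)
        then show ?thesis .
      qed
      have wV: "?w \<in> V" using w by simp
      have "br x ?w \<in> upper M' (i * p + j)" if "x \<in> M'" for x
      proof -
        obtain y c where x: "y \<in> M" "x = y + c *s s" using M'(1)[OF \<open>x \<in> M'\<close>] by blast
        have yV: "y \<in> V" using x M by blast
        have "br y ?w \<in> upper M i" using w x by simp
        then have 1: "br y ?w \<in> upper M' (i * p + j)"
          using \<open>upper M i \<subseteq> upper M' (i * p)\<close> upper_mono[OF M'(2), of "i * p" "i * p + j"] by auto
        have "p - j = Suc (p - Suc j)" using Suc.prems by simp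
        then have "br s ?w \<in> upper M' (i * p + j)" using Suc by simp
        then have "c *s br s ?w \<in> upper M' (i * p + j)"
          by (rule subspace_scale[OF subspace_upper[OF M'(2)]])
        with 1 have "br y ?w + c *s br s ?w \<in> upper M' (i * p + j)"
          by (rule subspace_add[OF subspace_upper[OF M'(2)]])
        then show ?thesis
          using x(2) by (simp only: br_add_left[OF yV V_scale[OF s(1)] wV] br_scale_left[OF s(1) wV])
      qed
      then show ?case using wV by simp
    qed
    from this[of _ p] show ?case by (auto simp: add.commute)
  qed simp
  then show ?thesis using M(3) unfolding nil_def by (meson subset_trans)
qed

text \<open>
  The Engel--Jacobson argument. Take a largest subalgebra \<open>M\<close> that is stable under \<open>f\<close> and for which the
  series \<open>upper M\<close> exhausts \<open>V\<close>. If \<open>M \<noteq> V\<close>, the first term \<open>U\<close> of that series not contained in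
  \<open>M\<close> satisfies \<open>[M, U] \<subseteq> M\<close>. Being stable under \<open>f\<close>, it contains a generalized eigenvector \<open>s \<notin> M\<close> that is an
  eigenvector modulo \<open>M\<close>; then \<open>M + \<K>s\<close> is a larger such subalgebra, as \<open>br s\<close> is nilpotent
  (the eigenvalue of \<open>s\<close> is nonzero because \<open>f\<close> is injective). So \<open>M = V\<close>, and
  the first step of the series \<open>upper V\<close>, which is the centre, cannot be zero.
\<close>

theorem center_nonzero:
  assumes "V \<noteq> {0}"
  shows "\<exists>z\<in>V. z \<noteq> 0 \<and> (\<forall>x\<in>V. br x z = 0)"
proof -
  obtain S where S: "finite S" "V \<subseteq> span S" using finite_dim_V by blast
  define good where "good b \<longleftrightarrow> finite b \<and> independent b \<and> span b \<subseteq> V \<and> nil (span b) \<and>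
    (\<forall>x\<in>span b. f x \<in> span b) \<and> (\<forall>x\<in>span b. \<forall>y\<in>span b. br x y \<in> span b)" for b
  have "upper {0} (Suc 0) = V" using br_zero_left by auto
  then have "nil {0}" unfolding nil_def by (metis order_refl)
  then have "good {}"
    unfolding good_def using V_zero by (simp add: br_zero_left f_zero independent_empty)
  moreover have "card b \<le> card S" if "good b" for b
    using that independent_span_bound[OF S(1), of b] S(2) span_superset[of b]
    unfolding good_def by blast
  ultimately obtain b where b: "good b" and max: "\<And>b'. good b' \<Longrightarrow> card b' \<le> card b"
    using ex_has_greatest_nat[of good "{}" card "Suc (card S)"] by (auto simp: less_Suc_eq_le)
  let ?M = "span b"
  have M: "?M \<subseteq> V" "subspace ?M" "nil ?M" and Mf: "\<And>x. x \<in> ?M \<Longrightarrow> f x \<in> ?M"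
    and Mbr: "\<And>x y. x \<in> ?M \<Longrightarrow> y \<in> ?M \<Longrightarrow> br x y \<in> ?M"
    using b subspace_span unfolding good_def by blast+
  have "V \<subseteq> ?M"
  proof (rule ccontr)
    assume "\<not> V \<subseteq> ?M"
    moreover obtain N where "V \<subseteq> upper ?M N" using M(3) unfolding nil_def by blast
    ultimately have ex: "\<not> upper ?M N \<subseteq> ?M" by auto
    define i where "i = (LEAST i. \<not> upper ?M i \<subseteq> ?M)"
    have i: "\<not> upper ?M i \<subseteq> ?M" unfolding i_def by (rule LeastI[of _ N]) (rule ex)
    have "i \<noteq> 0" using i span_zero by auto
    then obtain j where j: "i = Suc j" using not0_implies_Suc by blast
    have "upper ?M j \<subseteq> ?M" using not_less_Least[of j "\<lambda>i. \<not> upper ?M i \<subseteq> ?M"] j unfolding i_def by auto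
    let ?U = "upper ?M i"
    interpret U: closed_endomorphism_on scale ?U f
    proof
      show "subspace ?U" using subspace_upper M by blast
      show "f x \<in> ?U" if "x \<in> ?U" for x using f_upper[of ?M] M Mf that by blast
      show "\<exists>S. finite S \<and> ?U \<subseteq> span S" using finite_dim_V upper_subset by blast
    qed (use upper_subset f_add f_scale in \<open>blast+\<close>)
    have "\<not> (\<forall>l. U.E {l} \<subseteq> ?M)"
      using i U.gen_eig_subset_if_singletons[of ?M UNIV] M U.gen_eig_UNIV by blast
    then obtain l v where "v \<in> U.E {l}" "v \<notin> ?M" by blast
    then obtain s where s: "s \<in> U.E {l}" "s \<notin> ?M" "shift l s \<in> ?M"
      using U.exists_eigenvector_modulo[of v "{l}" ?M] span_zero by auto
    have sU: "s \<in> ?U" using s U.gen_eig_subset by blast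
    have sV: "s \<in> V" using sU upper_subset by blast
    have sE: "s \<in> E {l}"
      using s(1) by (induction rule: gen_eig.induct)
        (use upper_subset in \<open>auto intro: gen_eig.intros\<close>)
    have "l \<noteq> 0"
    proof
      assume "l = 0"
      have "x = 0" if "x \<in> E {0}" for x
        using that by (induction rule: gen_eig.induct) (auto intro: f_inj)
      then show False using sE s(2) \<open>l = 0\<close> span_zero by metis
    qed
    then obtain p where p: "\<And>v. v \<in> V \<Longrightarrow> (br s ^^ p) v = 0" using ad_nilpotent sE by blast
    have Ms: "br x s \<in> ?M" if "x \<in> ?M" for x
      using sU that \<open>upper ?M j \<subseteq> ?M\<close> unfolding j by auto
    have sM: "br s x \<in> ?M" if "x \<in> ?M" for x
      using Ms[OF that] br_anti[OF sV, of x] that M(1) span_neg by auto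
    let ?b = "insert s b"
    have ins: "\<exists>y\<in>?M. \<exists>c. x = y + c *s s" if "x \<in> span ?b" for x
    proof -
      obtain c where "x - c *s s \<in> span b" using \<open>x \<in> span ?b\<close> span_breakdown_eq by blast
      then show ?thesis by (intro bexI[of _ "x - c *s s"] exI[of _ c]) simp_all
    qed
    have sub: "?M \<subseteq> span ?b" by (intro span_mono) auto
    have sb: "s \<in> span ?b" by (simp add: span_base)
    have bV: "span ?b \<subseteq> V"
      using M(1) sV span_superset[of b] by (intro span_minimal subspace_V) auto
    have "good ?b" unfolding good_def
    proof (intro conjI ballI)
      show "finite ?b" "independent ?b"
        using b s independent_insertI unfolding good_def by auto
      show "span ?b \<subseteq> V" by (rule bV)
      show "nil (span ?b)"
        by (rule nil_extend[OF M(2,1,3) sV sM p ins bV])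
      show "f x \<in> span ?b" if x: "x \<in> span ?b" for x
      proof -
        obtain y c where y: "y \<in> ?M" "x = y + c *s s" using ins[OF x] by blast
        have "f x = f y + c *s (shift l s + l *s s)"
          using y M(1) sV by (simp add: f_add f_scale V_scale subset_iff)
        also have "\<dots> \<in> span ?b"
          using Mf[OF y(1)] s(3) sub sb by (intro span_add span_scale) auto
        finally show ?thesis .
      qed
      show "br x x' \<in> span ?b" if x: "x \<in> span ?b" "x' \<in> span ?b" for x x'
      proof -
        obtain y c where y: "y \<in> ?M" "x = y + c *s s" using ins[OF x(1)] by blast
        obtain y' c' where y': "y' \<in> ?M" "x' = y' + c' *s s" using ins[OF x(2)] by blast
        have V: "y \<in> V" "y' \<in> V" using y y' M by auto
        have "br x x' = br y y' + c' *s br y s + c *s br s y'"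
          unfolding y(2) y'(2) using V sV
          by (simp add: br_add_left br_add_right br_scale_left br_scale_right br_self V_scale V_add
              algebra_simps)
        also have "\<dots> \<in> ?M"
          using Mbr Ms sM y y' by (intro span_add span_scale) auto
        finally show ?thesis using sub by blast
      qed
    qed
    moreover have "card ?b > card b"
      using b s(2) span_base unfolding good_def by (metis card_insert_disjoint lessI)
    ultimately show False using max by fastforce
  qed
  then have "?M = V" using M(1) by blast
  then have "nil V" using M(3) by simp
  then obtain n where n: "V \<subseteq> upper V n" unfolding nil_def by blast
  have "upper V 1 \<noteq> {0}"
  proof
    assume eq: "upper V 1 = {0}"
    have "upper V i \<subseteq> {0}" for i
      by (induction i) (use eq in auto)
    then show False using n assms V_zero by blast
  qed
  then show ?thesis using subspace_0[OF subspace_upper[of V 1]] by auto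
qed

end

section \<open>Odd forms and the symplectic derivation\<close>

lemma sgn2_simps [simp]: "sgn2 0 = 1" "sgn2 1 = - 1"
  by (simp_all add: sgn2_def)

context vector_space
begin

text \<open>
  The Riesz representation for a nondegenerate bilinear form in finite dimension. The key is
  that vectors orthogonal to a finite set separate every \<open>v\<close> outside its span; with these the
  prescribed values on a basis are attained one at a time.
\<close>

lemma functional_represented:
  assumes V: "subspace V" "finite S" "V \<subseteq> span S"
    and bil: "bilinear_between scale V (*) UNIV B"
    and nondeg: "\<And>v. v \<in> V \<Longrightarrow> (\<And>u. u \<in> V \<Longrightarrow> B u v = 0) \<Longrightarrow> v = 0"
    and lin: "linear_between scale V (*) UNIV \<phi>"
  shows "\<exists>u\<in>V. \<forall>v\<in>V. B u v = \<phi> v"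
proof -
  note V_closed = subspace_add[OF V(1)] subspace_diff[OF V(1)] subspace_scale[OF V(1)]
  have addl: "B (x + y) z = B x z + B y z" and addr: "B x (y + z) = B x y + B x z"
    if "x \<in> V" "y \<in> V" "z \<in> V" for x y z
    using bil that unfolding bilinear_between_def linear_between_def by blast+
  have scl: "B (c *s x) y = c * B x y" and scr: "B x (c *s y) = c * B x y"
    if "x \<in> V" "y \<in> V" for x y c
    using bil that unfolding bilinear_between_def linear_between_def by blast+
  have subl: "B (x - y) z = B x z - B y z" if "x \<in> V" "y \<in> V" "z \<in> V" for x y z
    using addl[of "x - y" y z] that V_closed by simp
  have subr: "B x (y - z) = B x y - B x z" if "x \<in> V" "y \<in> V" "z \<in> V" for x y z
    using addr[of x "y - z" z] that V_closed by simp
  have separate: "\<exists>u\<in>V. B u v \<noteq> 0 \<and> (\<forall>t\<in>T. B u t = 0)"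
    if "finite T" "T \<subseteq> V" "v \<in> V" "v \<notin> span T" for T v
    using that
  proof (induction T arbitrary: v)
    case empty
    then show ?case using nondeg[of v] by auto
  next
    case (insert t T)
    show ?case
    proof (cases "t \<in> span T")
      case True
      then have v: "v \<notin> span T" using insert.prems by (simp add: span_redundant)
      have "\<exists>u\<in>V. B u v \<noteq> 0 \<and> (\<forall>t\<in>T. B u t = 0)" using insert v by simp
      then obtain u where u: "u \<in> V" "B u v \<noteq> 0" "\<forall>t\<in>T. B u t = 0" by blast
      have "subspace {x \<in> V. B u x = 0}"
        using u(1) V_closed subspace_0[OF V(1)] scr[of u 0 0]
        by (auto simp: subspace_def addr scr)
      then have "span T \<subseteq> {x \<in> V. B u x = 0}" using u insert.prems by (intro span_minimal) auto
      then show ?thesis using u True by auto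
    next
      case False
      then obtain u1 where u1: "u1 \<in> V" "B u1 t \<noteq> 0" "\<forall>t\<in>T. B u1 t = 0"
        using insert.IH[of t] insert.prems by auto
      \<comment> \<open>The coefficient makes \<open>u1\<close> orthogonal to \<open>v - c t\<close>, so correcting \<open>u2\<close> by a multiple of \<open>u1\<close>
        to make it orthogonal to \<open>t\<close> does not change its value on \<open>v - c t\<close>.\<close>
      let ?c = "B u1 v / B u1 t"
      have tV: "t \<in> V" and vV: "v \<in> V" using insert by auto
      have "v - ?c *s t \<notin> span T"
        using insert.prems(3) span_breakdown_eq by blast
      then obtain u2 where u2: "u2 \<in> V" "B u2 (v - ?c *s t) \<noteq> 0" "\<forall>t\<in>T. B u2 t = 0"
        using insert.IH[of "v - ?c *s t"] insert.prems tV V_closed by auto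
      let ?u = "u2 - (B u2 t / B u1 t) *s u1"
      have uV: "?u \<in> V" using u1 u2 V_closed by simp
      have ux: "B ?u x = B u2 x - B u2 t / B u1 t * B u1 x" if "x \<in> V" for x
        using that u1(1) u2(1) V_closed by (simp add: subl scl)
      have "B ?u v = B u2 (v - ?c *s t)"
        using u1 u2 tV vV V_closed by (simp add: ux subr scr)
      moreover have "\<forall>x\<in>insert t T. B ?u x = 0"
        using u1 u2 tV insert.prems by (auto simp: ux subset_iff)
      ultimately show ?thesis using u2(2) uV by (intro bexI[of _ ?u]) auto
    qed
  qed
  obtain T where T: "T \<subseteq> V" "independent T" "V \<subseteq> span T" using maximal_independent_subset by blast
  have "finite T" using independent_span_bound[OF V(2) T(2)] T(1) V(3) by auto
  then have "\<exists>u\<in>V. \<forall>t\<in>T. B u t = \<phi> t"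
    using T(1,2)
  proof (induction T)
    case empty
    then show ?case using subspace_0[OF V(1)] by auto
  next
    case (insert t T)
    then have t: "t \<notin> span T" "independent T" by (simp_all add: independent_insert)
    then obtain u where u: "u \<in> V" "\<forall>t\<in>T. B u t = \<phi> t" using insert by auto
    obtain w where w: "w \<in> V" "B w t \<noteq> 0" "\<forall>t\<in>T. B w t = 0"
      using separate[of T t] insert t by auto
    let ?u = "u + ((\<phi> t - B u t) / B w t) *s w"
    have "B ?u x = B u x + (\<phi> t - B u t) / B w t * B w x" if "x \<in> V" for x
      using that u w V_closed by (simp add: addl scl)
    then have "\<forall>x\<in>insert t T. B ?u x = \<phi> x" using u w insert.prems by (auto simp: subset_iff)
    then show ?case using u w V_closed by (intro bexI[of _ ?u]) auto
  qed
  then obtain u where u: "u \<in> V" "\<forall>t\<in>T. B u t = \<phi> t" by blast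
  have p: "\<phi> (x + y) = \<phi> x + \<phi> y" "\<phi> (c *s x) = c * \<phi> x" if "x \<in> V" "y \<in> V" for x y c
    using lin that unfolding linear_between_def by blast+
  have "subspace {x \<in> V. B u x = \<phi> x}"
    using u(1) V_closed subspace_0[OF V(1)] scr[of u 0 0] p(2)[of 0 0 0]
    by (auto simp: subspace_def addr scr p)
  then have "span T \<subseteq> {x \<in> V. B u x = \<phi> x}" using u T by (intro span_minimal) auto
  then show ?thesis using u T by blast
qed

end

context lie_superalgebra
begin

sublocale vs: vector_space "scl L"
  by (rule vector_space)

lemma part_subset: "part L \<alpha> \<subseteq> carr L"
proof
  fix x assume x: "x \<in> part L \<alpha>"
  have "0 \<in> part L \<beta>" for \<beta> using vs.subspace_0[OF subspace_part] .
  then show "x \<in> carr L" unfolding carr_def using x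
    by (cases \<alpha>) (auto intro: exI[of _ x] exI[of _ 0])
qed

lemma part_in: "x \<in> part L \<alpha> \<Longrightarrow> x \<in> carr L"
  using part_subset by blast

lemma carrE:
  assumes "x \<in> carr L"
  obtains u v where "u \<in> part L 0" "v \<in> part L 1" "x = u + v"
  using assms unfolding carr_def by blast

lemma subspace_carr: "vs.subspace (carr L)"
  unfolding carr_def by (rule vs.subspace_sums[OF subspace_part subspace_part])

lemmas part_add = vs.subspace_add[OF subspace_part]
  and part_diff = vs.subspace_diff[OF subspace_part]
  and part_scale = vs.subspace_scale[OF subspace_part]
  and part_zero = vs.subspace_0[OF subspace_part]
  and carr_add = vs.subspace_add[OF subspace_carr]
  and carr_diff = vs.subspace_diff[OF subspace_carr]
  and carr_scale = vs.subspace_scale[OF subspace_carr]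
  and carr_neg = vs.subspace_neg[OF subspace_carr]
  and carr_zero = vs.subspace_0[OF subspace_carr]

lemma part_sum_unique:
  assumes "u \<in> part L 0" "v \<in> part L 1" "u' \<in> part L 0" "v' \<in> part L 1" "u + v = u' + v'"
  shows "u = u'" "v = v'"
proof -
  have eq: "u - u' = v' - v" using assms(5) by (simp add: algebra_simps)
  have "u - u' \<in> part L 0" "v' - v \<in> part L 1" using assms by (simp_all add: part_diff)
  then have "u - u' \<in> part L 0 \<inter> part L 1" unfolding eq by simp
  then have "u - u' = 0" unfolding part_Int by simp
  then show "u = u'" "v = v'" using eq by simp_all
qed

lemma brac_in: "x \<in> carr L \<Longrightarrow> y \<in> carr L \<Longrightarrow> brac L x y \<in> carr L"
  using bilinear_brac unfolding bilinear_between_def linear_between_def by blast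

lemma brac_add:
  assumes "x \<in> carr L" "y \<in> carr L" "z \<in> carr L"
  shows "brac L (x + y) z = brac L x z + brac L y z" "brac L x (y + z) = brac L x y + brac L x z"
  using bilinear_brac assms unfolding bilinear_between_def linear_between_def by blast+

lemma brac_scale:
  assumes "x \<in> carr L" "y \<in> carr L"
  shows "brac L (scl L c x) y = scl L c (brac L x y)" "brac L x (scl L c y) = scl L c (brac L x y)"
  using bilinear_brac assms unfolding bilinear_between_def linear_between_def by blast+

lemma brac_zero: "x \<in> carr L \<Longrightarrow> brac L 0 x = 0" "x \<in> carr L \<Longrightarrow> brac L x 0 = 0"
  using brac_scale[of 0 x 0] brac_scale[of x 0 0] carr_zero by simp_all

lemma brac_neg:
  assumes "x \<in> carr L" "y \<in> carr L"
  shows "brac L (- x) y = - brac L x y" "brac L x (- y) = - brac L x y"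
  using brac_scale[OF assms, of "- 1"] by (simp_all add: assms)

lemma brac_diff:
  assumes "x \<in> carr L" "y \<in> carr L" "z \<in> carr L"
  shows "brac L (x - y) z = brac L x z - brac L y z" "brac L x (y - z) = brac L x y - brac L x z"
  using brac_add[of x "- y" z] brac_add[of x y "- z"] assms by (simp_all add: carr_neg brac_neg)

lemma brac_part:
  "x \<in> part L 0 \<Longrightarrow> y \<in> part L \<beta> \<Longrightarrow> brac L x y \<in> part L \<beta>"
  "x \<in> part L \<beta> \<Longrightarrow> y \<in> part L 0 \<Longrightarrow> brac L x y \<in> part L \<beta>"
  "x \<in> part L 1 \<Longrightarrow> y \<in> part L 1 \<Longrightarrow> brac L x y \<in> part L 0"
  using brac_degree[of x 0 y \<beta>] brac_degree[of x \<beta> y 0] brac_degree[of x 1 y 1] by (cases \<beta>; simp)+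

end

locale odd_quadratic_lie = lie_superalgebra L
  for L :: "('k::field, 'a::ab_group_add) superalg" +
  fixes B :: "'a \<Rightarrow> 'a \<Rightarrow> 'k"
  assumes odd_quadratic: "odd_quadratic L B"
begin

lemma form_bilinear: "bilinear_between (scl L) (carr L) (*) UNIV B"
  using odd_quadratic unfolding odd_quadratic_def bilinear_form_def by blast

lemma form_add:
  assumes "x \<in> carr L" "y \<in> carr L" "z \<in> carr L"
  shows "B (x + y) z = B x z + B y z" "B x (y + z) = B x y + B x z"
  using form_bilinear assms unfolding bilinear_between_def linear_between_def by blast+

lemma form_scale:
  assumes "x \<in> carr L" "y \<in> carr L"
  shows "B (scl L c x) y = c * B x y" "B x (scl L c y) = c * B x y"
  using form_bilinear assms unfolding bilinear_between_def linear_between_def by blast+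

lemma form_zero: "x \<in> carr L \<Longrightarrow> B 0 x = 0" "x \<in> carr L \<Longrightarrow> B x 0 = 0"
  using form_scale[of 0 x 0] form_scale[of x 0 0] carr_zero by simp_all

lemma form_neg:
  assumes "x \<in> carr L" "y \<in> carr L"
  shows "B (- x) y = - B x y" "B x (- y) = - B x y"
  using form_scale[OF assms, of "- 1"] assms by simp_all

lemma form_diff:
  assumes "x \<in> carr L" "y \<in> carr L" "z \<in> carr L"
  shows "B (x - y) z = B x z - B y z" "B x (y - z) = B x y - B x z"
  using form_add[of x "- y" z] form_add[of x y "- z"] assms by (simp_all add: carr_neg form_neg)

lemma form_odd: "x \<in> part L \<alpha> \<Longrightarrow> y \<in> part L \<alpha> \<Longrightarrow> B x y = 0"
  using odd_quadratic unfolding odd_quadratic_def odd_form_def by blast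

lemma form_invariant:
  "x \<in> carr L \<Longrightarrow> y \<in> carr L \<Longrightarrow> z \<in> carr L \<Longrightarrow> B (brac L x y) z = B x (brac L y z)"
  using odd_quadratic unfolding odd_quadratic_def by blast

lemma form_sym_homogeneous: "x \<in> part L \<alpha> \<Longrightarrow> y \<in> part L \<beta> \<Longrightarrow> B x y = B y x"
proof (cases "\<alpha> = \<beta>")
  case False
  then have "\<alpha> * \<beta> = 0" by (cases \<alpha>; cases \<beta>) auto
  then show "x \<in> part L \<alpha> \<Longrightarrow> y \<in> part L \<beta> \<Longrightarrow> B x y = B y x"
    using odd_quadratic unfolding odd_quadratic_def by (metis mult_1 sgn2_simps(1))
qed (simp add: form_odd)

lemma form_sym:
  assumes "x \<in> carr L" "y \<in> carr L"
  shows "B x y = B y x"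
proof -
  obtain u v where x: "u \<in> part L 0" "v \<in> part L 1" "x = u + v" using assms(1) by (rule carrE)
  obtain u' v' where y: "u' \<in> part L 0" "v' \<in> part L 1" "y = u' + v'" using assms(2) by (rule carrE)
  show ?thesis
    unfolding x(3) y(3)
    using x y form_sym_homogeneous[OF x(1) y(1)] form_sym_homogeneous[OF x(1) y(2)]
      form_sym_homogeneous[OF x(2) y(1)] form_sym_homogeneous[OF x(2) y(2)]
    by (simp add: part_in carr_add form_add)
qed

lemma form_nondegenerate:
  assumes "x \<in> carr L" "\<And>y. y \<in> carr L \<Longrightarrow> B x y = 0"
  shows "x = 0"
  using odd_quadratic assms unfolding odd_quadratic_def nondegenerate_form_def by blast

lemma form_nondegenerate_homogeneous:
  assumes "x \<in> part L \<alpha>" "\<And>y. y \<in> part L (\<alpha> + 1) \<Longrightarrow> B x y = 0"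
  shows "x = 0"
proof (rule form_nondegenerate)
  show x: "x \<in> carr L" using assms part_in by blast
  fix y assume "y \<in> carr L"
  then obtain u v where y: "u \<in> part L 0" "v \<in> part L 1" "y = u + v" by (rule carrE)
  have "B x u = 0 \<and> B x v = 0"
    using assms y form_odd[OF assms(1)] by (cases \<alpha>) auto
  then show "B x y = 0" using y x by (simp add: form_add part_in)
qed

end

locale odd_symplectic_quadratic = odd_quadratic_lie L B
  for L :: "('k::field, 'a::ab_group_add) superalg" and B +
  fixes \<omega> :: "'a \<Rightarrow> 'a \<Rightarrow> 'k"
  assumes odd_symplectic: "odd_symplectic L \<omega>"
begin

lemma omega_bilinear: "bilinear_between (scl L) (carr L) (*) UNIV \<omega>"
  using odd_symplectic unfolding odd_symplectic_def bilinear_form_def by blast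

lemma omega_add:
  assumes "x \<in> carr L" "y \<in> carr L" "z \<in> carr L"
  shows "\<omega> (x + y) z = \<omega> x z + \<omega> y z" "\<omega> x (y + z) = \<omega> x y + \<omega> x z"
  using omega_bilinear assms unfolding bilinear_between_def linear_between_def by blast+

lemma omega_scale:
  assumes "x \<in> carr L" "y \<in> carr L"
  shows "\<omega> (scl L c x) y = c * \<omega> x y" "\<omega> x (scl L c y) = c * \<omega> x y"
  using omega_bilinear assms unfolding bilinear_between_def linear_between_def by blast+

lemma omega_odd: "x \<in> part L \<alpha> \<Longrightarrow> y \<in> part L \<alpha> \<Longrightarrow> \<omega> x y = 0"
  using odd_symplectic unfolding odd_symplectic_def odd_form_def by blast

lemma omega_skew_homogeneous: "x \<in> part L \<alpha> \<Longrightarrow> y \<in> part L \<beta> \<Longrightarrow> \<omega> x y = - \<omega> y x"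
proof (cases "\<alpha> = \<beta>")
  case False
  then have "\<alpha> * \<beta> = 0" by (cases \<alpha>; cases \<beta>) auto
  then show "x \<in> part L \<alpha> \<Longrightarrow> y \<in> part L \<beta> \<Longrightarrow> \<omega> x y = - \<omega> y x"
    using odd_symplectic unfolding odd_symplectic_def by (metis mult_1 sgn2_simps(1))
qed (simp add: omega_odd)

lemma omega_skew:
  assumes "x \<in> carr L" "y \<in> carr L"
  shows "\<omega> x y = - \<omega> y x"
proof -
  obtain u v where x: "u \<in> part L 0" "v \<in> part L 1" "x = u + v" using assms(1) by (rule carrE)
  obtain u' v' where y: "u' \<in> part L 0" "v' \<in> part L 1" "y = u' + v'" using assms(2) by (rule carrE)
  show ?thesis
    unfolding x(3) y(3)
    using x y omega_skew_homogeneous[OF x(1) y(1)] omega_skew_homogeneous[OF x(1) y(2)]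
      omega_skew_homogeneous[OF x(2) y(1)] omega_skew_homogeneous[OF x(2) y(2)]
    by (simp add: part_in carr_add omega_add)
qed

lemma omega_closed:
  assumes "x \<in> part L \<alpha>" "y \<in> part L \<beta>" "z \<in> part L \<gamma>"
  shows "sgn2 (\<gamma> * \<alpha>) * \<omega> x (brac L y z) + sgn2 (\<alpha> * \<beta>) * \<omega> y (brac L z x)
    + sgn2 (\<beta> * \<gamma>) * \<omega> z (brac L x y) = 0"
  using odd_symplectic assms unfolding odd_symplectic_def by blast

lemma omega_nondegenerate:
  assumes "x \<in> carr L" "\<And>y. y \<in> carr L \<Longrightarrow> \<omega> x y = 0"
  shows "x = 0"
  using odd_symplectic assms unfolding odd_symplectic_def nondegenerate_form_def by blast

lemma finite_span: "\<exists>S. finite S \<and> carr L \<subseteq> vs.span S"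
  using finite_dim by blast

text \<open>
  The Leibniz rule for \<open>\<delta>\<close> is the closedness of \<open>\<omega>\<close>: invariance of \<open>B\<close> and super skew-symmetry of the
  bracket turn the three cyclic terms, paired with \<open>w\<close>, into those of
  \<open>[\<delta> x, y] + [x, \<delta> y] - \<delta> [x, y]\<close>. Evenness of \<open>\<delta>\<close> holds because both forms are odd.
\<close>

theorem symplectic_derivation_exists: "\<exists>\<delta>. symplectic_derivation L B \<omega> \<delta>"
proof -
  obtain S where S: "finite S" "carr L \<subseteq> vs.span S" using finite_span by blast
  have "\<forall>x\<in>carr L. \<exists>u\<in>carr L. \<forall>y\<in>carr L. B u y = \<omega> x y"
  proof
    fix x assume x: "x \<in> carr L"
    show "\<exists>u\<in>carr L. \<forall>y\<in>carr L. B u y = \<omega> x y"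
    proof (rule vs.functional_represented[OF subspace_carr S form_bilinear])
      show "v = 0" if "v \<in> carr L" "\<And>u. u \<in> carr L \<Longrightarrow> B u v = 0" for v
        using that form_nondegenerate form_sym by metis
      show "linear_between (scl L) (carr L) (*) UNIV (\<omega> x)"
        using omega_bilinear x unfolding bilinear_between_def by blast
    qed
  qed
  then obtain \<delta> where \<delta>: "\<And>x. x \<in> carr L \<Longrightarrow> \<delta> x \<in> carr L"
    and \<omega>: "\<And>x y. x \<in> carr L \<Longrightarrow> y \<in> carr L \<Longrightarrow> B (\<delta> x) y = \<omega> x y"
    by metis
  have unique: "u = v" if "u \<in> carr L" "v \<in> carr L" "\<And>y. y \<in> carr L \<Longrightarrow> B u y = B v y" for u v
    using form_nondegenerate[of "u - v"] that by (simp add: carr_diff form_diff)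
  have add: "\<delta> (x + y) = \<delta> x + \<delta> y" if "x \<in> carr L" "y \<in> carr L" for x y
    by (rule unique) (use that in \<open>simp_all add: \<delta> \<omega> carr_add form_add omega_add\<close>)
  have scale: "\<delta> (scl L c x) = scl L c (\<delta> x)" if "x \<in> carr L" for x c
    by (rule unique) (use that in \<open>simp_all add: \<delta> \<omega> carr_scale form_scale omega_scale\<close>)
  have part: "\<delta> x \<in> part L \<alpha>" if x: "x \<in> part L \<alpha>" for x \<alpha>
  proof -
    have xc: "x \<in> carr L" using x part_in by blast
    obtain u v where uv: "u \<in> part L 0" "v \<in> part L 1" "\<delta> x = u + v" using \<delta>[OF xc] by (rule carrE)
    have B: "B u y + B v y = \<omega> x y" if "y \<in> carr L" for y
      using \<omega>[OF xc that] uv that by (simp add: form_add part_in)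
    show ?thesis
    proof (cases "\<alpha> = 0")
      case True
      have "v = 0"
        by (rule form_nondegenerate_homogeneous[OF uv(2)])
          (use B part_in form_odd[OF uv(1)] omega_odd[OF x] True in fastforce)
      then show ?thesis using uv True by simp
    next
      case False
      then have 1: "\<alpha> = 1" by simp
      have "u = 0"
        by (rule form_nondegenerate_homogeneous[OF uv(1)])
          (use B part_in form_odd[OF uv(2)] omega_odd[OF x] 1 in fastforce)
      then show ?thesis using uv 1 by simp
    qed
  qed
  have hom: "\<delta> (brac L x y) = brac L (\<delta> x) y + brac L x (\<delta> y)"
    if x: "x \<in> part L \<alpha>" and y: "y \<in> part L \<beta>" for x y \<alpha> \<beta>
  proof (rule unique)
    note c = part_in[OF x] part_in[OF y]
    show "\<delta> (brac L x y) \<in> carr L" "brac L (\<delta> x) y + brac L x (\<delta> y) \<in> carr L"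
      using c by (simp_all add: \<delta> brac_in carr_add)
    have key: "B (\<delta> (brac L x y)) w = B (brac L (\<delta> x) y + brac L x (\<delta> y)) w"
      if w: "w \<in> part L \<gamma>" for w \<gamma>
    proof -
      note cw = part_in[OF w]
      have 1: "\<omega> x (brac L y w) = B (brac L (\<delta> x) y) w"
        using c cw by (simp add: \<delta> brac_in \<omega>[symmetric] form_invariant)
      have swap: "brac L w x = - scl L (sgn2 (\<gamma> * \<alpha>)) (brac L x w)" using skew_super w x by blast
      have 2: "\<omega> y (brac L w x) = sgn2 (\<gamma> * \<alpha>) * (sgn2 (\<beta> * \<alpha>) * B (brac L x (\<delta> y)) w)"
      proof -
        have "\<omega> y (brac L w x) = - sgn2 (\<gamma> * \<alpha>) * B (\<delta> y) (brac L x w)"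
          unfolding swap using c cw
          by (simp add: \<delta> brac_in \<omega>[symmetric] form_neg form_scale carr_scale carr_neg)
        also have "B (\<delta> y) (brac L x w) = B (brac L (\<delta> y) x) w"
          using c cw by (simp add: \<delta> form_invariant)
        also have "brac L (\<delta> y) x = - scl L (sgn2 (\<beta> * \<alpha>)) (brac L x (\<delta> y))"
          using skew_super[OF part[OF y] x] .
        finally show ?thesis using c cw
          by (simp add: \<delta> brac_in form_neg form_scale carr_scale)
      qed
      have 3: "\<omega> w (brac L x y) = - B (\<delta> (brac L x y)) w"
        using omega_skew[of w "brac L x y"] c cw by (simp add: brac_in \<omega>)
      have sum: "sgn2 (\<gamma> * \<alpha>) * B (brac L (\<delta> x) y) w
          + sgn2 (\<alpha> * \<beta>) * (sgn2 (\<gamma> * \<alpha>) * (sgn2 (\<beta> * \<alpha>) * B (brac L x (\<delta> y)) w))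
          = sgn2 (\<beta> * \<gamma>) * B (\<delta> (brac L x y)) w"
        using omega_closed[OF x y w] unfolding 1 2 3 by simp
      have "B (\<delta> (brac L x y)) w = B (brac L (\<delta> x) y) w + B (brac L x (\<delta> y)) w"
      proof (cases "\<gamma> = \<alpha> + \<beta>")
        case True
        \<comment> \<open>Then both sides pair two elements of the same degree.\<close>
        have "brac L (\<delta> x) y \<in> part L \<gamma>" "brac L x (\<delta> y) \<in> part L \<gamma>"
            "\<delta> (brac L x y) \<in> part L \<gamma>"
          unfolding True by (rule brac_degree[OF part[OF x] y] brac_degree[OF x part[OF y]]
              part[OF brac_degree[OF x y]])+
        then show ?thesis using form_odd[OF _ w] by simp
      next
        case False
        have neg: "c = a + b" if "- a - b = - c" for a b c :: 'k
          using arg_cong[OF that, of uminus] by (simp add: add.commute)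
        show ?thesis
          using sum False by (cases \<alpha>; cases \<beta>; cases \<gamma>) (simp_all add: neg)
      qed
      then show ?thesis using c cw by (simp add: \<delta> brac_in form_add)
    qed
    fix w assume "w \<in> carr L"
    then obtain u v where w: "u \<in> part L 0" "v \<in> part L 1" "w = u + v" by (rule carrE)
    show "B (\<delta> (brac L x y)) w = B (brac L (\<delta> x) y + brac L x (\<delta> y)) w"
      using key[OF w(1)] key[OF w(2)] w c
      by (simp add: part_in \<delta> brac_in carr_add form_add(2))
  qed
  have der: "\<delta> (brac L x y) = brac L (\<delta> x) y + brac L x (\<delta> y)"
    if x: "x \<in> part L \<alpha>" and y: "y \<in> carr L" for x y \<alpha>
  proof -
    obtain u v where y: "u \<in> part L 0" "v \<in> part L 1" "y = u + v" using y by (rule carrE)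
    show ?thesis unfolding y(3)
      using hom[OF x y(1)] hom[OF x y(2)] x y by (simp add: part_in brac_add add brac_in \<delta>)
  qed
  have inj: "inj_on \<delta> (carr L)"
  proof (rule inj_onI)
    fix x y assume xy: "x \<in> carr L" "y \<in> carr L" "\<delta> x = \<delta> y"
    have "\<omega> (x - y) w = 0" if "w \<in> carr L" for w
      using \<omega>[OF xy(1) that] \<omega>[OF xy(2) that] xy that
        omega_add(1)[of "x - y" y w] by (simp add: carr_diff)
    then show "x = y" using omega_nondegenerate[of "x - y"] xy by (simp add: carr_diff)
  qed
  have "\<exists>x\<in>carr L. \<delta> x = v" if v: "v \<in> carr L" for v
  proof -
    have "\<exists>x\<in>carr L. \<forall>y\<in>carr L. \<omega> x y = B v y"
    proof (rule vs.functional_represented[OF subspace_carr S omega_bilinear])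
      show "x = 0" if "x \<in> carr L" "\<And>u. u \<in> carr L \<Longrightarrow> \<omega> u x = 0" for x
        using that omega_nondegenerate omega_skew by (metis neg_equal_0_iff_equal)
      show "linear_between (scl L) (carr L) (*) UNIV (B v)"
        using form_bilinear v unfolding bilinear_between_def by blast
    qed
    then obtain x where "x \<in> carr L" "\<forall>y\<in>carr L. \<omega> x y = B v y" by blast
    then show ?thesis using \<omega> \<delta> v by (intro bexI[of _ x] unique) auto
  qed
  then have "bij_betw \<delta> (carr L) (carr L)"
    using inj \<delta> unfolding bij_betw_def by blast
  then show ?thesis
    using \<delta> \<omega> add scale part der
    unfolding symplectic_derivation_def superderivation_def linear_between_def
    by (intro exI[of _ \<delta>]) (auto simp: image_subset_iff)
qed

end

section \<open>Manin decompositions from the spectrum, and central eigenvectors\<close>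

locale with_symplectic_derivation = odd_symplectic_quadratic L B \<omega>
  for L :: "('k::field, 'a::ab_group_add) superalg" and B \<omega> +
  fixes \<delta> :: "'a \<Rightarrow> 'a"
  assumes symplectic_derivation: "symplectic_derivation L B \<omega> \<delta>"
begin

lemma delta_linear: "linear_between (scl L) (carr L) (scl L) (carr L) \<delta>"
  using symplectic_derivation unfolding symplectic_derivation_def superderivation_def by blast

lemma delta_in: "x \<in> carr L \<Longrightarrow> \<delta> x \<in> carr L"
  using delta_linear unfolding linear_between_def by blast

lemma delta_add: "x \<in> carr L \<Longrightarrow> y \<in> carr L \<Longrightarrow> \<delta> (x + y) = \<delta> x + \<delta> y"
  using delta_linear unfolding linear_between_def by blast

lemma delta_scale: "x \<in> carr L \<Longrightarrow> \<delta> (scl L c x) = scl L c (\<delta> x)"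
  using delta_linear unfolding linear_between_def by blast

lemma delta_part: "x \<in> part L \<alpha> \<Longrightarrow> \<delta> x \<in> part L \<alpha>"
proof -
  have "\<delta> ` part L \<alpha> \<subseteq> part L (\<alpha> + 0)"
    using symplectic_derivation unfolding symplectic_derivation_def superderivation_def by blast
  then show "x \<in> part L \<alpha> \<Longrightarrow> \<delta> x \<in> part L \<alpha>" by (cases \<alpha>) auto
qed

lemma omega_eq: "x \<in> carr L \<Longrightarrow> y \<in> carr L \<Longrightarrow> \<omega> x y = B (\<delta> x) y"
  using symplectic_derivation unfolding symplectic_derivation_def by blast

lemma delta_bij: "bij_betw \<delta> (carr L) (carr L)"
  using symplectic_derivation unfolding symplectic_derivation_def by blast

lemma delta_surj: "v \<in> carr L \<Longrightarrow> \<exists>x\<in>carr L. \<delta> x = v"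
  using delta_bij unfolding bij_betw_def by (metis imageE)

lemma delta_zero: "\<delta> 0 = 0"
  using delta_scale[OF carr_zero, of 0] by simp

lemma delta_eq_0: "x \<in> carr L \<Longrightarrow> \<delta> x = 0 \<Longrightarrow> x = 0"
  using delta_bij delta_zero carr_zero unfolding bij_betw_def inj_on_def by metis

lemma delta_skew:
  "x \<in> carr L \<Longrightarrow> y \<in> carr L \<Longrightarrow> B (\<delta> x) y = - B x (\<delta> y)"
  using omega_skew[of x y] by (simp add: omega_eq delta_in form_sym[of x])

lemma delta_brac:
  assumes "x \<in> carr L" "y \<in> carr L"
  shows "\<delta> (brac L x y) = brac L (\<delta> x) y + brac L x (\<delta> y)"
proof -
  obtain u v where x: "u \<in> part L 0" "v \<in> part L 1" "x = u + v" using assms(1) by (rule carrE)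
  have "\<delta> (brac L w y) = brac L (\<delta> w) y + brac L w (\<delta> y)" if "w \<in> part L \<alpha>" for w \<alpha>
    using symplectic_derivation that assms(2)
    unfolding symplectic_derivation_def superderivation_def by auto
  from this[OF x(1)] this[OF x(2)] show ?thesis
    unfolding x(3) using x assms(2)
    by (simp add: part_in brac_add delta_add delta_in brac_in add_ac)
qed

sublocale der: derivation_on "scl L" "carr L" \<delta> "brac L"
  by unfold_locales
    (simp_all add: subspace_carr delta_in delta_add delta_scale brac_in brac_add brac_scale delta_brac)

text \<open>
  Skewness of \<open>\<delta>\<close> gives \<open>(p + q) B(x, y) = 0\<close> for eigenvectors with eigenvalues \<open>p\<close> and \<open>q\<close>; a double
  induction extends this to generalized eigenvectors.
\<close>

lemma form_gen_eig:
  assumes "x \<in> der.E P" "y \<in> der.E Q" "\<And>p q. p \<in> P \<Longrightarrow> q \<in> Q \<Longrightarrow> p + q \<noteq> 0"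
  shows "B x y = 0"
  using assms(1,2)
proof (induction arbitrary: y rule: gen_eig.induct)
  case gen_eig_zero
  then show ?case using der.gen_eig_subset[of Q] form_zero by blast
next
  case outer: (gen_eig_step x p)
  show ?case using outer.prems
  proof (induction rule: gen_eig.induct)
    case gen_eig_zero
    then show ?case using outer.hyps form_zero by blast
  next
    case (gen_eig_step y q)
    have xy: "x \<in> carr L" "y \<in> carr L" using outer gen_eig_step by blast+
    have "y \<in> der.E Q" by (rule gen_eig.gen_eig_step[OF gen_eig_step.hyps])
    then have "B (\<delta> x - scl L p x) y = 0" by (rule outer.IH)
    moreover have "B x (\<delta> y - scl L q y) = 0" by (rule gen_eig_step.IH)
    ultimately have "B (\<delta> x) y = p * B x y" "B x (\<delta> y) = q * B x y"
      using xy by (simp_all add: form_diff form_scale delta_in carr_scale)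
    then have "(p + q) * B x y = 0"
      using delta_skew[OF xy] by (simp add: distrib_right flip: eq_neg_iff_add_eq_0)
    then show ?case using assms(3) outer.hyps gen_eig_step.hyps by simp
  qed
qed

lemma gen_eig_components:
  assumes "x \<in> der.E P" "u \<in> part L 0" "v \<in> part L 1" "x = u + v"
  shows "u \<in> der.E P \<and> v \<in> der.E P"
  using assms
proof (induction arbitrary: u v rule: gen_eig.induct)
  case gen_eig_zero
  then have "u = 0" "v = 0" using part_sum_unique[of u v 0 0] part_zero by auto
  then show ?case by (simp add: gen_eig.gen_eig_zero)
next
  case (gen_eig_step x l)
  note uv = gen_eig_step.prems
  have "\<delta> x - scl L l x = (\<delta> u - scl L l u) + (\<delta> v - scl L l v)"
    unfolding uv(3) using uv by (simp add: delta_add part_in vs.scale_right_distrib)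
  then have "\<delta> u - scl L l u \<in> der.E P \<and> \<delta> v - scl L l v \<in> der.E P"
    using uv by (intro gen_eig_step.IH) (simp_all add: part_diff delta_part part_scale)
  then show ?case
    using gen_eig.gen_eig_step[OF part_in[OF uv(1)] gen_eig_step.hyps(2)]
      gen_eig.gen_eig_step[OF part_in[OF uv(2)] gen_eig_step.hyps(2)] by blast
qed

lemma gen_eig_subsuperalgebra:
  assumes "\<And>p q. p \<in> P \<Longrightarrow> q \<in> P \<Longrightarrow> p + q \<in> P"
  shows "lie_subsuperalgebra L (der.E P)"
  unfolding lie_subsuperalgebra_def
proof (intro conjI ballI)
  show "vs.subspace (der.E P)" by (rule der.subspace_gen_eig)
  show "der.E P = {x + y | x y. x \<in> der.E P \<inter> part L 0 \<and> y \<in> der.E P \<inter> part L 1}" (is "_ = ?R")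
  proof
    show "der.E P \<subseteq> ?R"
    proof
      fix x assume x: "x \<in> der.E P"
      then have "x \<in> carr L" using der.gen_eig_subset by blast
      then obtain u v where uv: "u \<in> part L 0" "v \<in> part L 1" "x = u + v" by (rule carrE)
      then show "x \<in> ?R" using gen_eig_components[OF x uv] by blast
    qed
    show "?R \<subseteq> der.E P" using der.gen_eig_add by blast
  qed
  fix x y assume "x \<in> der.E P" "y \<in> der.E P"
  then have "brac L x y \<in> der.E {p + q | p q. p \<in> P \<and> q \<in> P}" by (rule der.gen_eig_br)
  then show "brac L x y \<in> der.E P" by (rule gen_eig_mono[rotated]) (use assms in auto)
qed

end

locale with_symplectic_derivation_closed = with_symplectic_derivation L B \<omega> \<delta>
  for L :: "('k::{alg_closed_field, field_char_0}, 'a::ab_group_add) superalg" and B \<omega> \<delta>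
begin

lemma closed_endomorphism_subspace:
  assumes "vs.subspace U" "U \<subseteq> carr L" "\<And>x. x \<in> U \<Longrightarrow> \<delta> x \<in> U"
  shows "closed_endomorphism_on (scl L) U \<delta>"
proof
  show "\<exists>S. finite S \<and> U \<subseteq> vs.span S" using finite_span assms(2) by blast
qed (use assms delta_add delta_scale in \<open>simp_all add: subset_iff\<close>)

text \<open>
  The summands are the positive and the negative part of \<open>\<delta>\<close> for a total order on the additive
  group of the field. They exhaust the algebra as \<open>\<delta>\<close> is injective, they are subalgebras as each sign is closed under
  addition, and they are isotropic as two elements of the same sign do not cancel.
\<close>

theorem manin_decomposition_exists:
  "\<exists>\<aa> \<bb>. special_odd_symplectic_odd_manin L \<aa> \<bb> B \<omega>"
proof -
  interpret C: closed_endomorphism_on "scl L" "carr L" \<delta>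
    by (rule closed_endomorphism_subspace) (simp_all add: subspace_carr delta_in)
  obtain P :: "'k set" where P0: "0 \<notin> P" and Padd: "\<And>x y. x \<in> P \<Longrightarrow> y \<in> P \<Longrightarrow> x + y \<in> P"
    and Ptot: "\<And>x. x \<noteq> 0 \<Longrightarrow> x \<in> P \<or> - x \<in> P"
    using total_cone_exists by blast
  let ?N = "uminus ` P"
  have N: "0 \<notin> ?N" using P0 by auto
  have Nadd: "x + y \<in> ?N" if "x \<in> ?N" "y \<in> ?N" for x y
  proof -
    have "- x + - y \<in> P" by (rule Padd) (use that in auto)
    then show ?thesis by (intro image_eqI[of _ _ "- x + - y"]) simp_all
  qed
  have disj: "P \<inter> ?N = {}"
  proof (rule ccontr)
    assume "P \<inter> ?N \<noteq> {}"
    then obtain p where "p \<in> P" "- p \<in> P" by auto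
    then show False using Padd[of p "- p"] P0 by simp
  qed
  have UN: "UNIV = (P \<union> ?N) \<union> {0}"
  proof -
    have "x \<in> (P \<union> ?N) \<union> {0}" for x using Ptot[of x] by (auto simp: image_iff intro: bexI[of _ "- x"])
    then show ?thesis by blast
  qed
  have E0: "x = 0" if "x \<in> der.E {0}" for x
    using that by (induction rule: gen_eig.induct) (auto intro: delta_eq_0)
  have sum: "carr L = {x + y | x y. x \<in> der.E P \<and> y \<in> der.E ?N}" (is "_ = ?R")
  proof
    show "carr L \<subseteq> ?R"
    proof
      fix x assume "x \<in> carr L"
      then have "x \<in> der.E ((P \<union> ?N) \<union> {0})"
        by (simp only: C.gen_eig_UNIV flip: UN)
      then obtain y z where y: "y \<in> der.E (P \<union> ?N)" "z \<in> der.E {0}" "x = y + z"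
        using der.gen_eig_Un[of x "P \<union> ?N" "{0}"] P0 N by auto
      then have "x \<in> der.E (P \<union> ?N)" using E0[of z] by simp
      then show "x \<in> ?R" using der.gen_eig_Un[OF _ disj] by blast
    qed
    show "?R \<subseteq> carr L"
    proof clarify
      fix y z assume "y \<in> der.E P" "z \<in> der.E ?N"
      then show "y + z \<in> carr L"
        using subsetD[OF der.gen_eig_subset[of P]] subsetD[OF der.gen_eig_subset[of ?N]]
        by (intro carr_add)
    qed
  qed
  have nonzero: "p + q \<noteq> 0" if "p \<in> R" "q \<in> R" "R = P \<or> R = ?N" for p q R
  proof -
    have "p + q \<in> R" using that Padd Nadd by blast
    then show ?thesis using that(3) P0 N by auto
  qed
  have iso: "B x y = 0" "\<omega> x y = 0" if "x \<in> der.E R" "y \<in> der.E R" "R = P \<or> R = ?N" for x y R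
  proof -
    show B: "B x y = 0"
      by (rule form_gen_eig[OF that(1,2) nonzero[OF _ _ that(3)]])
    have "B (\<delta> x) y = 0"
      by (rule form_gen_eig[OF der.gen_eig_f[OF that(1)] that(2)
          nonzero[OF _ _ that(3)]])
    then show "\<omega> x y = 0" 
      using that(1,2) subsetD[OF der.gen_eig_subset[of R]] by (simp add: omega_eq)
  qed
  have "der.E P \<inter> der.E ?N = {0}"
    using der.gen_eig_disjoint[OF _ _ disj] gen_eig_zero by blast
  then have "special_odd_symplectic_odd_manin L (der.E P) (der.E ?N) B \<omega>"
    unfolding special_odd_symplectic_odd_manin_def
    using sum by (intro conjI ballI lie_superalgebra_axioms gen_eig_subsuperalgebra Padd Nadd
      odd_quadratic odd_symplectic iso[where R = P] iso[where R = ?N]) simp_all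
  then show ?thesis by blast
qed

text \<open>
  If the even part were zero, the odd form would vanish, so the even part is a nonzero Lie algebra
  with the injective derivation \<open>\<delta>\<close>. Its centre is stable under \<open>\<delta>\<close>, hence contains an eigenvector.
\<close>

theorem central_even_eigenvector:
  assumes "carr L \<noteq> {0}"
  shows "\<exists>z l. z \<in> part L 0 \<and> z \<noteq> 0 \<and> l \<noteq> 0 \<and> \<delta> z = scl L l z \<and> (\<forall>x\<in>carr L. brac L z x = 0)"
proof -
  let ?V = "part L 0"
  interpret even: closed_endomorphism_on "scl L" ?V \<delta>
    by (rule closed_endomorphism_subspace) (simp_all add: subspace_part part_subset delta_part)
  have anti: "brac L x y = - brac L y x" if "x \<in> ?V" "y \<in> ?V" for x y
    using skew_super[OF that] by simp
  interpret even: lie_derivation "scl L" ?V \<delta> "brac L"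
  proof
    fix x y z assume V: "x \<in> ?V" "y \<in> ?V" "z \<in> ?V"
    show "brac L x (brac L y z) = brac L (brac L x y) z + brac L y (brac L x z)"
    proof -
      have "brac L x (brac L y z) + brac L y (brac L z x) + brac L z (brac L x y) = 0"
        using super_jacobi[OF V] by simp
      moreover have "brac L y (brac L z x) = - brac L y (brac L x z)"
        using anti[OF V(3,1)] V by (simp add: brac_neg part_in brac_in)
      moreover have "brac L z (brac L x y) = - brac L (brac L x y) z"
        by (rule anti[OF V(3) brac_part(1)[OF V(1,2)]])
      ultimately show ?thesis by (simp add: algebra_simps)
    qed
  next
    fix x assume V: "x \<in> ?V"
    have "brac L x x = - brac L x x" using anti V by blast
    then have "scl L 2 (brac L x x) = 0"
      using vs.scale_left_distrib[of 1 1 "brac L x x"] by (simp add: eq_neg_iff_add_eq_0)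
    then show "brac L x x = 0" by simp
  qed (simp_all add: part_in brac_part brac_add brac_scale delta_brac delta_eq_0)
  have "?V \<noteq> {0}"
  proof
    assume V: "?V = {0}"
    have "v = 0" if "v \<in> part L 1" for v
      using form_nondegenerate_homogeneous[OF that] V form_zero part_in[OF that] by auto
    then have "carr L \<subseteq> {0}" using V by (auto elim!: carrE)
    then have "carr L = {0}" using carr_zero by blast
    then show False using assms by blast
  qed
  let ?Z = "{z \<in> ?V. \<forall>x\<in>?V. brac L x z = 0}"
  interpret center: closed_endomorphism_on "scl L" ?Z \<delta>
  proof (rule closed_endomorphism_subspace)
    show "vs.subspace ?Z"
      by (auto simp: vs.subspace_def part_zero part_add part_scale brac_zero brac_add brac_scale part_in)
    show "?Z \<subseteq> carr L" using part_in by blast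
    show "\<delta> z \<in> ?Z" if z: "z \<in> ?Z" for z
    proof -
      have "brac L x (\<delta> z) = 0" if "x \<in> ?V" for x
        using delta_brac[of x z] delta_part[OF that] part_in[OF that] part_in[of z 0] that z
        by (auto simp: delta_zero)
      then show ?thesis using z delta_part by blast
    qed
  qed
  obtain z0 where z0: "z0 \<in> ?Z" "z0 \<noteq> 0" using even.center_nonzero[OF \<open>?V \<noteq> {0}\<close>] by blast
  obtain z l where z: "z \<in> center.E UNIV" "z \<noteq> 0" "\<delta> z - scl L l z = 0"
    using center.exists_eigenvector_modulo[of z0 UNIV "{0}"] z0 center.gen_eig_UNIV by auto
  then have zZ: "z \<in> ?Z" using center.gen_eig_subset by blast
  then have zV: "z \<in> ?V" by blast
  note zc = part_in[OF zV]
  have central0: "brac L z x = 0" if "x \<in> ?V" for x using anti[OF zV that] zZ that by simp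
  \<comment> \<open>The even part acts on the odd part by the transpose of its action on itself.\<close>
  have central1: "brac L z x = 0" if x: "x \<in> part L 1" for x
  proof (rule form_nondegenerate_homogeneous)
    show "brac L z x \<in> part L 1" using brac_part(1) zV x by blast
    fix y assume "y \<in> part L (1 + 1)"
    then have y: "y \<in> ?V" by simp
    have xy: "brac L x y = - brac L y x" using skew_super[OF x y] by simp
    have "B (brac L z x) y = B z (brac L x y)"
      using form_invariant zc x y part_in by blast
    also have "\<dots> = - B (brac L z y) x"
      unfolding xy using zc part_in[OF x] part_in[OF y] by (simp add: form_neg brac_in form_invariant)
    also have "\<dots> = 0" using central0[OF y] part_in[OF x] by (simp add: form_zero)
    finally show "B (brac L z x) y = 0" .
  qed
  have "brac L z x = 0" if "x \<in> carr L" for x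
    using that
  proof (rule carrE)
    fix u v assume uv: "u \<in> part L 0" "v \<in> part L 1" "x = u + v"
    then show ?thesis using central0[of u] central1[of v] zc by (simp add: brac_add part_in)
  qed
  moreover have "l \<noteq> 0" using z delta_eq_0[OF zc] by auto
  ultimately show ?thesis using z zV by (intro exI[of _ z] exI[of _ l]) simp
qed

end

section \<open>Reduction along a central even eigenvector\<close>

context lie_superalgebra
begin

text \<open>
  The super Jacobi identity, read as the statement that \<open>ad x\<close> is a superderivation of degree \<open>\<alpha>\<close>.
\<close>

lemma super_jacobi_derivation:
  assumes x: "x \<in> part L \<alpha>" and y: "y \<in> part L \<beta>" and w: "w \<in> carr L"
  shows "brac L x (brac L y w)
    = brac L (brac L x y) w + scl L (sgn2 (\<alpha> * \<beta>)) (brac L y (brac L x w))"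
proof -
  have hom: "brac L x (brac L y w)
      = brac L (brac L x y) w + scl L (sgn2 (\<alpha> * \<beta>)) (brac L y (brac L x w))"
    if w: "w \<in> part L \<gamma>" for w \<gamma>
  proof -
    note c = part_in[OF x] part_in[OF y] part_in[OF w]
    have 1: "brac L y (brac L w x) = - scl L (sgn2 (\<gamma> * \<alpha>)) (brac L y (brac L x w))"
      unfolding skew_super[OF w x] using c by (simp add: brac_neg brac_scale brac_in carr_scale)
    have 2: "brac L w (brac L x y) = - scl L (sgn2 (\<gamma> * (\<alpha> + \<beta>))) (brac L (brac L x y) w)"
      by (rule skew_super[OF w brac_degree[OF x y]])
    have "scl L (sgn2 (\<gamma> * \<alpha>)) (brac L x (brac L y w))
        - scl L (sgn2 (\<alpha> * \<beta>)) (scl L (sgn2 (\<gamma> * \<alpha>)) (brac L y (brac L x w)))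
        - scl L (sgn2 (\<beta> * \<gamma>)) (scl L (sgn2 (\<gamma> * (\<alpha> + \<beta>))) (brac L (brac L x y) w)) = 0"
      using super_jacobi[OF x y w] unfolding 1 2 by simp
    then show ?thesis
      by (cases \<alpha>; cases \<beta>; cases \<gamma>) (simp_all add: algebra_simps eq_neg_iff_add_eq_0)
  qed
  obtain u v where uv: "u \<in> part L 0" "v \<in> part L 1" "w = u + v" using w by (rule carrE)
  show ?thesis
    unfolding uv(3) using hom[OF uv(1)] hom[OF uv(2)] uv part_in[OF x] part_in[OF y]
    by (simp add: part_in brac_add brac_in vs.scale_right_distrib add_ac)
qed

end

locale central_reduction = with_symplectic_derivation L B \<omega> \<delta>
  for L :: "('k::field_char_0, 'a::ab_group_add) superalg" and B \<omega> \<delta> +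
  fixes z e :: 'a and \<mu> :: 'k
  assumes z_even: "z \<in> part L 0"
    and z_central: "x \<in> carr L \<Longrightarrow> brac L z x = 0"
    and z_eigen: "\<delta> z = scl L \<mu> z"
    and mu_nonzero: "\<mu> \<noteq> 0"
    and e_odd: "e \<in> part L 1"
    and z_e: "B z e = 1"
begin

text \<open>
  The vectors \<open>z\<close> and \<open>e\<close> span a hyperbolic plane for \<open>B\<close>, and \<open>proj\<close> is the orthogonal projection onto its
  complement \<open>\<hh>\<close>. On \<open>z\<^sup>\<bottom>\<close>, which contains all brackets, it only removes a multiple of the central \<open>z\<close>.
  It therefore identifies \<open>z\<^sup>\<bottom> / \<K>z\<close> with \<open>\<hh>\<close>, and identities of \<open>L\<close> pass to \<open>H\<close> by applying \<open>proj\<close>.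
\<close>

definition proj :: "'a \<Rightarrow> 'a" where
  "proj x = x - scl L (B e x) z - scl L (B z x) e"

definition H :: "('k, 'a) superalg" where
  "H = \<lparr>scl = scl L, part = \<lambda>\<alpha>. {x \<in> part L \<alpha>. B e x = 0 \<and> B z x = 0},
    brac = \<lambda>x y. proj (brac L x y)\<rparr>"

text \<open>
  The data of the extension, written \<open>D\<close>, \<open>x\<^sub>0\<close>, \<open>k\<close>, \<open>c\<^sub>1\<close> in \<open>double_extension_data\<close>, and the
  derivation that \<open>\<delta>\<close> induces on \<open>z\<^sup>\<bottom> / \<K>z\<close>.
\<close>

definition ext_der :: "'a \<Rightarrow> 'a" where "ext_der x = proj (brac L e x)"
definition ext_square :: "'a" where "ext_square = proj (brac L e e)"
definition ext_const :: "'k" where "ext_const = B e (brac L e e)"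
definition ext_shift :: "'a" where "ext_shift = proj (\<delta> e)"
definition red_delta :: "'a \<Rightarrow> 'a" where "red_delta x = proj (\<delta> x)"

lemma H_simps [simp]:
  "scl H = scl L" "part H \<alpha> = {x \<in> part L \<alpha>. B e x = 0 \<and> B z x = 0}"
  "brac H x y = proj (brac L x y)"
  by (simp_all add: H_def)

lemma z_in: "z \<in> carr L" and e_in: "e \<in> carr L"
  using part_in z_even e_odd by blast+

lemma e_z: "B e z = 1" and z_z: "B z z = 0" and e_e: "B e e = 0"
  using z_e form_sym[OF e_in z_in] form_odd z_even e_odd by auto

lemma proj_in: "x \<in> carr L \<Longrightarrow> proj x \<in> carr L"
  by (simp add: proj_def carr_diff carr_scale z_in e_in)

lemma proj_orth: "x \<in> carr L \<Longrightarrow> B e (proj x) = 0" "x \<in> carr L \<Longrightarrow> B z (proj x) = 0"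
  by (simp_all add: proj_def form_diff form_scale carr_diff carr_scale z_in e_in e_z z_z e_e z_e)

lemma proj_add: "x \<in> carr L \<Longrightarrow> y \<in> carr L \<Longrightarrow> proj (x + y) = proj x + proj y"
  by (simp add: proj_def form_add z_in e_in vs.scale_left_distrib)

lemma proj_scale: "x \<in> carr L \<Longrightarrow> proj (scl L c x) = scl L c (proj x)"
  by (simp add: proj_def form_scale z_in e_in vs.scale_right_diff_distrib)

lemma proj_zero: "proj 0 = 0"
  using proj_scale[OF carr_zero, of 0] by simp

lemma proj_neg: "x \<in> carr L \<Longrightarrow> proj (- x) = - proj x"
  using proj_scale[of x "- 1"] by simp

lemma proj_diff: "x \<in> carr L \<Longrightarrow> y \<in> carr L \<Longrightarrow> proj (x - y) = proj x - proj y"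
  using proj_add[of x "- y"] by (simp add: carr_neg proj_neg)

lemma proj_z: "proj z = 0" and proj_e: "proj e = 0"
  by (simp_all add: proj_def e_z z_z e_e z_e)

lemma proj_part: "x \<in> part L \<alpha> \<Longrightarrow> proj x \<in> part H \<alpha>"
proof -
  assume x: "x \<in> part L \<alpha>"
  have "proj x \<in> part L \<alpha>"
  proof (cases "\<alpha> = 0")
    case True
    then show ?thesis using x form_odd[OF z_even, of x] z_even by (simp add: proj_def part_diff part_scale)
  next
    case False
    then show ?thesis using x form_odd[OF e_odd, of x] e_odd by (simp add: proj_def part_diff part_scale)
  qed
  then show ?thesis using proj_orth part_in[OF x] by simp
qed

lemma proj_fixes: "B e x = 0 \<Longrightarrow> B z x = 0 \<Longrightarrow> proj x = x"
  by (simp add: proj_def)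

lemma carr_H: "carr H = {x \<in> carr L. B e x = 0 \<and> B z x = 0}"
proof
  show "carr H \<subseteq> {x \<in> carr L. B e x = 0 \<and> B z x = 0}"
    unfolding carr_def[of H] by (auto simp: part_in carr_add form_add z_in e_in)
  show "{x \<in> carr L. B e x = 0 \<and> B z x = 0} \<subseteq> carr H"
  proof clarify
    fix x assume x: "x \<in> carr L" "B e x = 0" "B z x = 0"
    obtain u v where uv: "u \<in> part L 0" "v \<in> part L 1" "x = u + v" using x(1) by (rule carrE)
    have "x = proj u + proj v"
      using proj_fixes[OF x(2,3)] uv by (simp add: proj_add part_in)
    then show "x \<in> carr H" unfolding carr_def using proj_part uv by blast
  qed
qed

lemma carr_HD: "x \<in> carr H \<Longrightarrow> x \<in> carr L" "x \<in> carr H \<Longrightarrow> B e x = 0" "x \<in> carr H \<Longrightarrow> B z x = 0"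
  by (simp_all add: carr_H)

lemma proj_in_H: "x \<in> carr L \<Longrightarrow> proj x \<in> carr H"
  by (simp add: carr_H proj_in proj_orth)

lemma proj_fixes_H: "x \<in> carr H \<Longrightarrow> proj x = x"
  by (simp add: carr_H proj_fixes)

lemma form_proj:
  assumes "x \<in> carr L" "y \<in> carr H"
  shows "B (proj x) y = B x y" "B y (proj x) = B y x"
proof -
  have y: "y \<in> carr L" "B e y = 0" "B z y = 0" using assms carr_HD by blast+
  show "B (proj x) y = B x y"
    using assms y by (simp add: proj_def form_diff form_scale carr_diff carr_scale z_in e_in)
  then show "B y (proj x) = B y x"
    using form_sym assms(1) y(1) proj_in by metis
qed

lemma central_right: "x \<in> carr L \<Longrightarrow> brac L x z = 0"
proof -
  have hom: "brac L x z = 0" if "x \<in> part L \<alpha>" for x \<alpha>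
    using skew_super[OF that z_even] z_central[OF part_in[OF that]] by simp
  assume "x \<in> carr L"
  then obtain u v where "u \<in> part L 0" "v \<in> part L 1" "x = u + v" by (rule carrE)
  then show ?thesis using hom z_in by (simp add: brac_add part_in)
qed

lemma brac_orth_z: "x \<in> carr L \<Longrightarrow> y \<in> carr L \<Longrightarrow> B z (brac L x y) = 0"
  using form_invariant[of z x y] by (simp add: z_in z_central form_zero)

lemma brac_proj:
  assumes "x \<in> carr L" "B z x = 0" "y \<in> carr L"
  shows "brac L (proj x) y = brac L x y" "brac L y (proj x) = brac L y x"
  using assms
  by (simp_all add: proj_def brac_diff brac_scale carr_scale z_in z_central central_right)

lemma brac_proj_brac:
  assumes "x \<in> carr L" "y \<in> carr L" "w \<in> carr L"
  shows "brac L (proj (brac L x y)) w = brac L (brac L x y) w"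
    "brac L w (proj (brac L x y)) = brac L w (brac L x y)"
  using brac_proj[of "brac L x y" w] assms by (simp_all add: brac_in brac_orth_z)

lemma delta_orth_z: "x \<in> carr L \<Longrightarrow> B z (\<delta> x) = - \<mu> * B z x"
  using delta_skew[of z x] by (simp add: z_in z_eigen form_scale)

lemma proj_delta_proj:
  assumes "x \<in> carr L" "B z x = 0"
  shows "proj (\<delta> (proj x)) = proj (\<delta> x)"
proof -
  have "\<delta> (proj x) = \<delta> x - scl L (B e x * \<mu>) z"
    using assms der.f_diff[of x "scl L (B e x) z"]
    by (simp add: proj_def carr_scale z_in delta_scale z_eigen)
  then show ?thesis
    using assms by (simp add: proj_diff proj_scale proj_z delta_in carr_scale z_in)
qed

lemma lie_superalgebra_H: "lie_superalgebra H"
proof (rule lie_superalgebra.intro)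
  show "vector_space (scl H)" by (simp add: vector_space)
  show "module.subspace (scl H) (part H \<alpha>)" for \<alpha>
    by (auto simp: vs.subspace_def part_zero part_add part_scale form_zero form_add form_scale
        z_in e_in part_in)
  show "part H 0 \<inter> part H 1 = {0}"
    using part_Int part_zero by (auto simp: form_zero z_in e_in)
  show "\<exists>S. finite S \<and> module.span (scl H) S = carr H"
  proof -
    obtain S where S: "finite S" "carr L \<subseteq> vs.span S" using finite_span by blast
    obtain T where T: "T \<subseteq> carr H" "vs.independent T" "carr H \<subseteq> vs.span T"
      using vs.maximal_independent_subset by blast
    have "finite T" using vs.independent_span_bound[OF S(1) T(2)] T S carr_HD(1) by blast
    moreover have "vs.subspace (carr H)"
      unfolding carr_H
      by (auto simp: vs.subspace_def carr_zero carr_add carr_scale form_zero form_add form_scale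
        z_in e_in)
    then have "vs.span T \<subseteq> carr H" using T(1) by (rule vs.span_minimal[rotated])
    ultimately show ?thesis using T(3) by auto
  qed
  show "bilinear_between (scl H) (carr H) (scl H) (carr H) (brac H)"
    unfolding bilinear_between_def linear_between_def
    by (auto simp: carr_HD brac_in proj_in_H brac_add brac_scale proj_add proj_scale)
  fix \<alpha> \<beta> \<gamma> x y w assume x: "x \<in> part H \<alpha>" and y: "y \<in> part H \<beta>"
  then have xL: "x \<in> part L \<alpha>" and yL: "y \<in> part L \<beta>" by simp_all
  note c = part_in[OF xL] part_in[OF yL]
  show "brac H x y \<in> part H (\<alpha> + \<beta>)"
    using proj_part[OF brac_degree[OF xL yL]] by simp
  show "brac H x y = - scl H (sgn2 (\<alpha> * \<beta>)) (brac H y x)"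
    using c skew_super[OF xL yL] by (simp add: proj_neg proj_scale brac_in carr_scale)
  assume "w \<in> part H \<gamma>"
  then have wL: "w \<in> part L \<gamma>" by simp
  note c = c part_in[OF wL]
  have "proj (scl L (sgn2 (\<gamma> * \<alpha>)) (brac L x (brac L y w)) +
      scl L (sgn2 (\<alpha> * \<beta>)) (brac L y (brac L w x)) +
      scl L (sgn2 (\<beta> * \<gamma>)) (brac L w (brac L x y))) = 0"
    unfolding super_jacobi[OF xL yL wL] by (rule proj_zero)
  then show "scl H (sgn2 (\<gamma> * \<alpha>)) (brac H x (brac H y w)) +
      scl H (sgn2 (\<alpha> * \<beta>)) (brac H y (brac H w x)) +
      scl H (sgn2 (\<beta> * \<gamma>)) (brac H w (brac H x y)) = 0"
    using c by (simp add: brac_proj_brac proj_add proj_scale brac_in carr_add carr_scale)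
qed

lemma odd_quadratic_H: "odd_quadratic H B"
  unfolding odd_quadratic_def
proof (intro conjI allI ballI)
  show "bilinear_form H B"
    unfolding bilinear_form_def bilinear_between_def linear_between_def
    by (simp add: carr_HD form_add form_scale)
  show "odd_form H B" unfolding odd_form_def using form_odd by auto
  show "B x y = sgn2 (\<alpha> * \<beta>) * B y x" if "x \<in> part H \<alpha>" "y \<in> part H \<beta>" for \<alpha> \<beta> x y
    using odd_quadratic that unfolding odd_quadratic_def by auto
  show "B (brac H x y) w = B x (brac H y w)" if "x \<in> carr H" "y \<in> carr H" "w \<in> carr H" for x y w
    using that carr_HD by (simp add: form_proj brac_in form_invariant)
  have nondeg: "x = 0" if x: "x \<in> carr H" "\<And>y. y \<in> carr H \<Longrightarrow> B x y = 0" for x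
  proof (rule form_nondegenerate)
    show "x \<in> carr L" using x carr_HD by blast
    show "B x y = 0" if "y \<in> carr L" for y
      using x(2)[OF proj_in_H[OF that]] form_proj(2)[OF that x(1)] by simp
  qed
  then show "nondegenerate_form H B"
    unfolding nondegenerate_form_def using form_sym carr_HD(1) by metis
qed

lemma omega_proj:
  assumes "x \<in> carr H" "y \<in> carr L" "B z y = 0"
  shows "\<omega> x (proj y) = \<omega> x y"
proof -
  have x: "x \<in> carr L" "B z x = 0" using assms carr_HD by auto
  have "B (\<delta> x) z = 0"
    using delta_orth_z[OF x(1)] x form_sym[OF delta_in[OF x(1)] z_in] by simp
  then show ?thesis
    using assms x by (simp add: proj_def omega_eq carr_diff carr_scale z_in delta_in form_diff form_scale)
qed

text \<open>
  Restricting \<open>\<omega>\<close> to \<open>\<hh>\<close> gives the form that \<open>\<omega>\<close> induces on the quotient, because \<open>z\<close> is orthogonal to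
  \<open>\<hh>\<close> also for \<open>\<omega>\<close>. Closedness is thus inherited. For nondegeneracy, an \<open>x \<in> \<hh>\<close> in the radical has
  \<open>\<delta> x\<close> orthogonal to \<open>z\<^sup>\<bottom>\<close>, so \<open>\<delta> x \<in> \<K>z = \<delta>(\<K>z)\<close> and \<open>x \<in> \<hh> \<inter> \<K>z = 0\<close>.
\<close>

lemma odd_symplectic_H: "odd_symplectic H \<omega>"
  unfolding odd_symplectic_def
proof (intro conjI allI ballI)
  show "bilinear_form H \<omega>"
    unfolding bilinear_form_def bilinear_between_def linear_between_def
    by (simp add: carr_HD omega_add omega_scale)
  show "odd_form H \<omega>" unfolding odd_form_def using omega_odd by auto
  show "\<omega> x y = - (sgn2 (\<alpha> * \<beta>) * \<omega> y x)" if "x \<in> part H \<alpha>" "y \<in> part H \<beta>" for \<alpha> \<beta> x y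
    using odd_symplectic that unfolding odd_symplectic_def by auto
  have nondeg: "x = 0" if x: "x \<in> carr H" "\<And>y. y \<in> carr H \<Longrightarrow> \<omega> x y = 0" for x
  proof -
    note xL = carr_HD[OF x(1)]
    \<comment> \<open>Both sides agree on \<open>z\<^sup>\<bottom>\<close> and on \<open>e\<close>.\<close>
    have "B (\<delta> x) y = B (\<delta> x) e * B z y" if y: "y \<in> carr L" for y
    proof -
      let ?y = "y - scl L (B z y) e"
      have y': "?y \<in> carr L" using y by (simp add: carr_diff carr_scale e_in)
      have "B z ?y = 0" using y by (simp add: form_diff form_scale z_in e_in carr_scale z_e)
      then have "\<omega> x ?y = 0" using omega_proj[OF x(1) y'] x(2)[OF proj_in_H[OF y']] by simp
      then show ?thesis
        using y y' xL by (simp add: omega_eq form_diff form_scale delta_in carr_scale e_in)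
    qed
    then have "\<delta> x = scl L (B (\<delta> x) e) z"
      using form_nondegenerate[of "\<delta> x - scl L (B (\<delta> x) e) z"] xL
      by (simp add: form_diff form_scale delta_in carr_diff carr_scale z_in)
    then have "\<delta> (x - scl L (B (\<delta> x) e / \<mu>) z) = 0"
      using xL mu_nonzero by (simp add: der.f_diff delta_scale carr_scale z_in z_eigen)
    then have "x - scl L (B (\<delta> x) e / \<mu>) z = 0"
      by (rule delta_eq_0[rotated]) (simp add: xL carr_diff carr_scale z_in)
    then have eq: "x = scl L (B (\<delta> x) e / \<mu>) z" by simp
    have "B e x = B (\<delta> x) e / \<mu>"
      by (subst eq) (simp add: form_scale e_in z_in e_z)
    then have "B (\<delta> x) e / \<mu> = 0" using xL(2) by metis
    then show "x = 0" by (intro trans[OF eq]) simp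
  qed
  then show "nondegenerate_form H \<omega>"
    unfolding nondegenerate_form_def using omega_skew carr_HD(1) by (metis neg_equal_0_iff_equal)
  fix \<alpha> \<beta> \<gamma> x y w assume xyw: "x \<in> part H \<alpha>" "y \<in> part H \<beta>" "w \<in> part H \<gamma>"
  then have L: "x \<in> part L \<alpha>" "y \<in> part L \<beta>" "w \<in> part L \<gamma>" by simp_all
  note c = part_in[OF L(1)] part_in[OF L(2)] part_in[OF L(3)]
  have "x \<in> carr H" "y \<in> carr H" "w \<in> carr H" using xyw c by (simp_all add: carr_H)
  then show "sgn2 (\<gamma> * \<alpha>) * \<omega> x (brac H y w) + sgn2 (\<alpha> * \<beta>) * \<omega> y (brac H w x)
      + sgn2 (\<beta> * \<gamma>) * \<omega> w (brac H x y) = 0"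
    using omega_closed[OF L] c by (simp add: omega_proj brac_in brac_orth_z)
qed

lemma symplectic_derivation_H: "symplectic_derivation H B \<omega> red_delta"
  unfolding symplectic_derivation_def superderivation_def
proof (intro conjI allI ballI)
  show "linear_between (scl H) (carr H) (scl H) (carr H) red_delta"
    unfolding linear_between_def
    by (auto simp: carr_HD red_delta_def delta_in proj_in_H delta_add delta_scale proj_add proj_scale)
  show "red_delta ` part H \<alpha> \<subseteq> part H (\<alpha> + 0)" for \<alpha>
  proof
    fix v assume "v \<in> red_delta ` part H \<alpha>"
    then obtain x where "x \<in> part L \<alpha>" "v = proj (\<delta> x)" unfolding red_delta_def by auto
    then show "v \<in> part H (\<alpha> + 0)" using proj_part delta_part by (cases \<alpha>) auto
  qed
  show "red_delta (brac H x y)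
      = brac H (red_delta x) y + scl H (sgn2 (0 * \<alpha>)) (brac H x (red_delta y))"
    if x: "x \<in> part H \<alpha>" and y: "y \<in> carr H" for \<alpha> x y
  proof -
    note xL = part_in[of x \<alpha>] and yL = carr_HD[OF y]
    have "B z (\<delta> x) = 0" "B z (\<delta> y) = 0" using x y xL yL by (auto simp: delta_orth_z)
    then show ?thesis
      using x xL yL
      by (simp add: red_delta_def proj_delta_proj brac_in brac_orth_z delta_brac brac_proj delta_in
          proj_add)
  qed
  show "\<omega> x y = B (red_delta x) y" if "x \<in> carr H" "y \<in> carr H" for x y
    using that carr_HD by (simp add: red_delta_def form_proj delta_in omega_eq)
  have inj: "inj_on red_delta (carr H)"
  proof (rule inj_onI)
    fix x y assume xy: "x \<in> carr H" "y \<in> carr H" "red_delta x = red_delta y"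
    interpret H: lie_superalgebra H by (rule lie_superalgebra_H)
    have xy': "x - y \<in> carr H" using xy H.carr_diff by blast
    note L = carr_HD[OF xy(1)] carr_HD[OF xy(2)]
    have "\<omega> (x - y) w = 0" if "w \<in> carr H" for w
    proof -
      note w = carr_HD[OF that]
      have "\<omega> (x - y) w = B (\<delta> x - \<delta> y) w"
        using L w by (simp add: omega_eq carr_diff der.f_diff)
      also have "\<dots> = B (proj (\<delta> x - \<delta> y)) w"
        using L that by (simp add: form_proj carr_diff delta_in)
      also have "\<dots> = 0"
        using L xy(3) w by (simp add: proj_diff delta_in form_zero red_delta_def)
      finally show ?thesis .
    qed
    then show "x = y"
      using odd_symplectic_H xy' unfolding odd_symplectic_def nondegenerate_form_def by auto
  qed
  have "red_delta ` carr H = carr H"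
  proof
    show "red_delta ` carr H \<subseteq> carr H"
      using carr_HD by (auto simp: red_delta_def intro!: proj_in_H delta_in)
    show "carr H \<subseteq> red_delta ` carr H"
    proof
      fix v assume v: "v \<in> carr H"
      then obtain x where x: "x \<in> carr L" "\<delta> x = v" using delta_surj carr_HD by blast
      have "B z x = 0" using delta_orth_z[OF x(1)] x carr_HD(3)[OF v] mu_nonzero by simp
      then have "v = red_delta (proj x)"
        using proj_delta_proj[OF x(1)] x proj_fixes_H[OF v] by (simp add: red_delta_def)
      then show "v \<in> red_delta ` carr H" using proj_in_H[OF x(1)] by blast
    qed
  qed
  then show "bij_betw red_delta (carr H) (carr H)" using inj unfolding bij_betw_def by blast
qed

lemma ext_der_superderivation: "superderivation H 1 ext_der"
  unfolding superderivation_def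
proof (intro conjI allI ballI)
  show "linear_between (scl H) (carr H) (scl H) (carr H) ext_der"
    unfolding linear_between_def
    by (auto simp: carr_HD ext_der_def e_in brac_in proj_in_H brac_add brac_scale proj_add proj_scale)
  show "ext_der ` part H \<alpha> \<subseteq> part H (\<alpha> + 1)" for \<alpha>
  proof
    fix v assume "v \<in> ext_der ` part H \<alpha>"
    then obtain x where x: "x \<in> part L \<alpha>" "v = proj (brac L e x)" unfolding ext_der_def by auto
    have "1 + \<alpha> = \<alpha> + 1" by (rule add.commute)
    then show "v \<in> part H (\<alpha> + 1)" using proj_part[OF brac_degree[OF e_odd x(1)]] x(2) by simp
  qed
  fix \<alpha> x y assume x: "x \<in> part H \<alpha>" and y: "y \<in> carr H"
  then have xL: "x \<in> part L \<alpha>" and yL: "y \<in> carr L" using carr_HD by simp_all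
  note c = part_in[OF xL] yL e_in
  show "ext_der (brac H x y)
      = brac H (ext_der x) y + scl H (sgn2 (1 * \<alpha>)) (brac H x (ext_der y))"
    using c super_jacobi_derivation[OF e_odd xL yL]
    by (simp add: ext_der_def brac_proj_brac proj_add proj_scale brac_in carr_scale)
qed

lemma brac_e_right: "x \<in> part L \<alpha> \<Longrightarrow> brac L x e = - scl L (sgn2 \<alpha>) (brac L e x)"
  using skew_super[OF _ e_odd, of x \<alpha>] by simp

lemma ext_der_skew: "skew_supersymmetric H B 1 ext_der"
  unfolding skew_supersymmetric_def
proof (intro allI ballI)
  fix \<alpha> x y assume x: "x \<in> part H \<alpha>" and y: "y \<in> carr H"
  then have xL: "x \<in> part L \<alpha>" and yL: "y \<in> carr L" using carr_HD by simp_all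
  note c = part_in[OF xL] yL e_in
  have xH: "x \<in> carr H" using x c by (simp add: carr_H)
  have "B x (ext_der y) = B (brac L x e) y"
    using xH c by (simp add: ext_der_def form_proj brac_in form_invariant)
  also have "\<dots> = - (sgn2 \<alpha> * B (brac L e x) y)"
    unfolding brac_e_right[OF xL] using c by (simp add: form_neg form_scale brac_in carr_scale)
  also have "B (brac L e x) y = B (ext_der x) y"
    using y c by (simp add: ext_der_def form_proj brac_in)
  finally show "B (ext_der x) y = - (sgn2 (1 * \<alpha>) * B x (ext_der y))"
    by (cases \<alpha>) simp_all
qed

lemma brac_e_e_e: "brac L e (brac L e e) = 0"
proof -
  let ?w = "brac L e (brac L e e)"
  have "?w + ?w + ?w = - (- ?w + - ?w + - ?w)" by simp
  also have "- ?w + - ?w + - ?w = 0" using super_jacobi[OF e_odd e_odd e_odd] by simp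
  finally have "?w + ?w + ?w = 0" by simp
  then have "scl L 3 (brac L e (brac L e e)) = 0"
    using vs.scale_left_distrib[of 1 2 "brac L e (brac L e e)"]
      vs.scale_left_distrib[of 1 1 "brac L e (brac L e e)"] by (simp add: add.assoc)
  then show ?thesis by simp
qed

lemma double_brac_e: "x \<in> carr L \<Longrightarrow> scl L 2 (brac L e (brac L e x)) = brac L (brac L e e) x"
  using super_jacobi_derivation[OF e_odd e_odd, of x]
    vs.scale_left_distrib[of 1 1 "brac L e (brac L e x)"] by (simp add: eq_diff_eq)

lemma delta_brac_e_e: "\<delta> (brac L e e) = scl L 2 (brac L e (\<delta> e))"
  using delta_brac[OF e_in e_in] brac_e_right[OF delta_part[OF e_odd]]
    vs.scale_left_distrib[of 1 1 "brac L e (\<delta> e)"] by simp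

lemma delta_e: "\<delta> e = ext_shift - scl L \<mu> e"
  using delta_orth_z[OF e_in] form_odd[OF e_odd delta_part[OF e_odd]]
  by (simp add: ext_shift_def proj_def z_e)

lemma brac_e_e: "brac L e e = ext_square + scl L ext_const z"
  by (simp add: ext_square_def ext_const_def proj_def brac_orth_z e_in)

lemma ext_shift_part: "ext_shift \<in> part H 1" and ext_square_part: "ext_square \<in> part H 0"
  unfolding ext_shift_def ext_square_def
  using proj_part[OF delta_part[OF e_odd]] proj_part[OF brac_part(3)[OF e_odd e_odd]] by blast+

lemma ext_in: "ext_shift \<in> carr H" "ext_square \<in> carr H" "ext_shift \<in> carr L" "ext_square \<in> carr L"
  using ext_shift_part ext_square_part part_in by (auto simp: carr_H)

text \<open>
  Pair \<open>\<delta> [e, e] = 2 [e, \<delta> e]\<close> with \<open>e\<close>: skewness of \<open>\<delta>\<close> and invariance of \<open>B\<close> give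
  \<open>3 B(\<delta> e, [e, e]) = 0\<close>. Expanding \<open>\<delta> e = c\<^sub>1 - \<mu> e\<close> and \<open>[e, e] = x\<^sub>0 + k z\<close> leaves the two terms of the
  statement.
\<close>

lemma form_shift_square: "B ext_shift ext_square = \<mu> * ext_const"
proof -
  let ?q = "brac L e e"
  have q: "?q \<in> carr L" and de: "\<delta> e \<in> carr L" using e_in brac_in delta_in by blast+
  have "- B (\<delta> e) ?q = 2 * B (\<delta> e) ?q"
  proof -
    have "- B (\<delta> e) ?q = B e (\<delta> ?q)" using delta_skew[OF e_in q] by simp
    also have "\<dots> = 2 * B e (brac L e (\<delta> e))"
      unfolding delta_brac_e_e using e_in de by (simp add: form_scale brac_in)
    also have "B e (brac L e (\<delta> e)) = B ?q (\<delta> e)" using form_invariant e_in de by simp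
    also have "\<dots> = B (\<delta> e) ?q" using form_sym q de by blast
    finally show ?thesis .
  qed
  then have "3 * B (\<delta> e) ?q = 0" by (simp add: eq_neg_iff_add_eq_0 neg_eq_iff_add_eq_0)
  then have "B (ext_shift - scl L \<mu> e) (ext_square + scl L ext_const z) = 0"
    unfolding delta_e[symmetric] brac_e_e[symmetric] by simp
  moreover have "B ext_shift z = 0"
    using form_sym[OF ext_in(3) z_in] carr_HD(3)[OF ext_in(1)] by simp
  ultimately show ?thesis
    using ext_in(3,4) carr_HD(2)[OF ext_in(2)]
    by (simp add: form_add form_diff form_scale carr_diff carr_add carr_scale z_in e_in e_z)
qed

text \<open>
  Each remaining compatibility condition is the component in \<open>\<hh>\<close> of an identity in \<open>L\<close>:
  \<open>[e, [e, e]] = 0\<close>, \<open>2 [e, [e, x]] = [[e, e], x]\<close>, \<open>\<delta> [e, e] = 2 [e, \<delta> e]\<close> and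
  \<open>\<delta> [e, x] = [\<delta> e, x] + [e, \<delta> x]\<close>.
\<close>

lemma double_extension_data_H:
  "double_extension_data H B \<omega> red_delta ext_der ext_square ext_const ext_shift \<mu>"
  unfolding double_extension_data_def
proof (intro conjI ballI)
  note e = e_in brac_in[OF e_in e_in] delta_in[OF e_in]
  show "ext_der ext_square = 0"
    using brac_e_e_e by (simp add: ext_der_def ext_square_def brac_proj_brac e_in proj_zero)
  show "ext_der (ext_der x) = scl H (1 / 2) (brac H ext_square x)" if "x \<in> carr H" for x
  proof -
    have x: "x \<in> carr L" using that carr_HD by blast
    have "brac H ext_square x = proj (scl L 2 (brac L e (brac L e x)))"
      using x by (simp add: ext_square_def brac_proj_brac e_in double_brac_e)
    then show ?thesis
      using x by (simp add: ext_der_def brac_proj_brac e_in brac_in proj_scale)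
  qed
  have shift: "ext_shift = \<delta> e + scl L \<mu> e" using delta_e by simp
  show "scl H 2 (ext_der ext_shift) = red_delta ext_square + scl H (2 * \<mu>) ext_square"
  proof -
    have "ext_der ext_shift = proj (brac L e (\<delta> e)) + scl L \<mu> ext_square"
      unfolding ext_der_def shift ext_square_def
      using e by (simp add: brac_add brac_scale carr_scale brac_in proj_add proj_scale)
    moreover have "scl L 2 (proj (brac L e (\<delta> e))) = proj (\<delta> (brac L e e))"
      unfolding delta_brac_e_e using e by (simp add: proj_scale brac_in)
    moreover have "proj (\<delta> (brac L e e)) = red_delta ext_square"
      unfolding red_delta_def ext_square_def
      using e by (intro proj_delta_proj[symmetric]) (simp_all add: brac_orth_z)
    ultimately show ?thesis by (simp add: vs.scale_right_distrib)
  qed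
  show "supercommutator H 0 red_delta 1 ext_der x + scl H \<mu> (ext_der x) = brac H ext_shift x"
    if "x \<in> carr H" for x
  proof -
    note x = carr_HD[OF that]
    have "red_delta (ext_der x) = proj (\<delta> (brac L e x))"
      unfolding red_delta_def ext_der_def
      using x e_in by (intro proj_delta_proj) (simp_all add: brac_in brac_orth_z)
    also have "\<dots> = proj (brac L (\<delta> e) x) + proj (brac L e (\<delta> x))"
      using x e by (simp add: delta_brac proj_add brac_in delta_in)
    also have "proj (brac L e (\<delta> x)) = ext_der (red_delta x)"
      unfolding red_delta_def ext_der_def
      using x e_in by (simp add: brac_proj delta_in delta_orth_z)
    finally show ?thesis
      unfolding shift supercommutator_def
      using x e by (simp add: ext_der_def brac_add brac_scale carr_scale proj_add proj_scale brac_in)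
  qed
qed (use lie_superalgebra_H odd_quadratic_H odd_symplectic_H symplectic_derivation_H
    ext_der_superderivation ext_der_skew ext_square_part ext_shift_part mu_nonzero form_shift_square
    in simp_all)

definition coords :: "'a \<Rightarrow> 'k \<times> 'a \<times> 'k" where
  "coords x = (B e x, proj x, B z x)"

lemma coords_decomposition: "x = proj x + scl L (B e x) z + scl L (B z x) e"
  by (simp add: proj_def)

lemma parity_aut_H:
  assumes "u \<in> part H 0" "v \<in> part H 1"
  shows "parity_aut H (u + v) = u - v"
proof -
  interpret H: lie_superalgebra H by (rule lie_superalgebra_H)
  show ?thesis
    unfolding parity_aut_def
  proof (rule the_equality)
    show "\<exists>u'\<in>part H 0. \<exists>v'\<in>part H 1. u + v = u' + v' \<and> u - v = u' - v'" using assms by blast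
    show "y = u - v" if "\<exists>u'\<in>part H 0. \<exists>v'\<in>part H 1. u + v = u' + v' \<and> y = u' - v'" for y
      using that assms H.part_sum_unique[of u v] by blast
  qed
qed

lemma parity_aut_brac_e:
  assumes "x \<in> carr H"
  shows "parity_aut H x \<in> carr H" "brac L x e = - brac L e (parity_aut H x)"
proof -
  interpret H: lie_superalgebra H by (rule lie_superalgebra_H)
  obtain u v where uv: "u \<in> part H 0" "v \<in> part H 1" "x = u + v" using assms by (rule H.carrE)
  have p: "parity_aut H x = u - v" using parity_aut_H uv by simp
  show "parity_aut H x \<in> carr H" unfolding p using uv H.part_in H.carr_diff by blast
  have L: "u \<in> part L 0" "v \<in> part L 1" using uv by simp_all
  show "brac L x e = - brac L e (parity_aut H x)"
    unfolding p unfolding uv(3) using L brac_e_right[OF L(1)] brac_e_right[OF L(2)] e_in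
    by (simp add: part_in brac_add brac_diff)
qed

lemma coords_brac:
  assumes x: "x \<in> carr L" and y: "y \<in> carr L"
  shows "coords (brac L x y) = brac (double_extension H B ext_der ext_square ext_const) (coords x) (coords y)"
proof -
  let ?X = "proj x" and ?Y = "proj y" and ?t = "B z x" and ?t' = "B z y"
  let ?P = "parity_aut H ?X"
  have XH: "?X \<in> carr H" and YH: "?Y \<in> carr H" using x y proj_in_H by blast+
  note X = carr_HD[OF XH] and Y = carr_HD[OF YH]
  have PH: "?P \<in> carr H" and Xe: "brac L ?X e = - brac L e ?P" using parity_aut_brac_e[OF XH] by blast+
  note P = carr_HD[OF PH]
  have "brac L x y = brac L (?X + scl L (B e x) z + scl L ?t e) (?Y + scl L (B e y) z + scl L ?t' e)"
    using coords_decomposition by metis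
  also have "\<dots> = brac L ?X ?Y + scl L ?t (brac L e ?Y) - scl L ?t' (brac L e ?P)
      + scl L (?t * ?t') (brac L e e)"
    using X Y P z_in e_in
    by (simp add: brac_add brac_scale carr_add carr_scale z_central central_right Xe brac_in
        vs.scale_right_distrib vs.scale_right_diff_distrib mult.commute)
  finally have br: "brac L x y = brac L ?X ?Y + scl L ?t (brac L e ?Y) - scl L ?t' (brac L e ?P)
      + scl L (?t * ?t') (brac L e e)" .
  have 1: "B e (brac L ?X ?Y) = B (ext_der ?X) ?Y"
    using YH X Y e_in by (simp add: ext_der_def form_proj brac_in form_invariant)
  have 2: "B e (brac L e w) = B ext_square w" if "w \<in> carr H" for w
    using that carr_HD[OF that] e_in by (simp add: ext_square_def form_proj brac_in form_invariant)
  have "B e (brac L x y) = B (ext_der ?X) ?Y + ?t * B ext_square ?Y - ?t' * B ext_square ?P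
      + ?t * ?t' * ext_const"
    unfolding br using X Y P e_in
    by (simp add: form_add form_diff form_scale brac_in carr_add carr_diff carr_scale 1 2[OF YH] 2[OF PH]
        ext_const_def)
  moreover have "proj (brac L x y) = brac H ?X ?Y + scl L ?t (ext_der ?Y) - scl L ?t' (ext_der ?P)
      + scl L (?t * ?t') ext_square"
    unfolding br using X Y P e_in
    by (simp add: proj_add proj_diff proj_scale brac_in carr_add carr_diff carr_scale ext_der_def
        ext_square_def)
  moreover have "B z (brac L x y) = 0" using brac_orth_z x y .
  ultimately show ?thesis unfolding coords_def double_extension_def by simp
qed

lemma coords_form:
  assumes x: "x \<in> carr L" and y: "y \<in> carr L"
  shows "double_extension_form B (coords x) (coords y) = B x y"
proof -
  have XH: "proj x \<in> carr H" and YH: "proj y \<in> carr H" using x y proj_in_H by blast+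
  note X = carr_HD[OF XH] and Y = carr_HD[OF YH]
  have "B x y = B (proj x + scl L (B e x) z + scl L (B z x) e) y"
    using coords_decomposition by metis
  also have "\<dots> = B (proj x) y + B e x * B z y + B z x * B e y"
    using X y z_in e_in by (simp add: form_add form_scale carr_add carr_scale)
  also have "B (proj x) y = B (proj x) (proj y)" using form_proj(2)[OF y XH] by simp
  finally show ?thesis by (simp add: double_extension_form_def coords_def)
qed

lemma coords_delta:
  assumes x: "x \<in> carr L"
  shows "coords (\<delta> x) = double_extension_derivation H B red_delta ext_shift \<mu> (coords x)"
proof -
  have XH: "proj x \<in> carr H" using x proj_in_H by blast
  note X = carr_HD[OF XH]
  have dx: "\<delta> x = \<delta> (proj x) + scl L (B e x * \<mu>) z + scl L (B z x) (\<delta> e)"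
    using delta_add[of "proj x + scl L (B e x) z" "scl L (B z x) e"]
      delta_add[of "proj x" "scl L (B e x) z"] coords_decomposition[of x] X z_in e_in
    by (simp add: delta_scale carr_add carr_scale z_eigen)
  have "proj (\<delta> x) = red_delta (proj x) + scl L (B z x) ext_shift"
    unfolding dx red_delta_def ext_shift_def using X z_in e_in
    by (simp add: proj_add proj_scale carr_add carr_scale delta_in proj_z)
  moreover have "B e (\<delta> x) = \<mu> * B e x - B ext_shift (proj x)"
  proof -
    have "B e (\<delta> x) = - B (\<delta> e) x" using delta_skew[OF e_in x] by simp
    also have "\<dots> = \<mu> * B e x - B ext_shift x"
      unfolding delta_e using ext_in x e_in by (simp add: form_diff form_scale carr_scale)
    also have "B ext_shift x = B ext_shift (proj x)" using form_proj(2)[OF x ext_in(1)] by simp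
    finally show ?thesis .
  qed
  moreover have "B z (\<delta> x) = - (\<mu> * B z x)" using delta_orth_z[OF x] by simp
  ultimately show ?thesis unfolding coords_def double_extension_derivation_def by simp
qed

lemma carr_double_extension: "carr (double_extension H B D x0 k) = UNIV \<times> carr H \<times> UNIV"
proof -
  have "p \<in> carr (double_extension H B D x0 k) \<longleftrightarrow> p \<in> UNIV \<times> carr H \<times> UNIV" for p
  proof -
    obtain s x t where p: "p = (s, x, t)" by (cases p)
    show ?thesis
      unfolding p carr_def double_extension_def by auto
  qed
  then show ?thesis by blast
qed

theorem coords_isometric_isomorphism:
  "isometric_isomorphism L B \<omega> (double_extension H B ext_der ext_square ext_const)
    (double_extension_form B) (double_extension_symplectic H B red_delta ext_shift \<mu>) coords"
  unfolding isometric_isomorphism_def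
proof (intro conjI allI ballI)
  let ?G = "double_extension H B ext_der ext_square ext_const"
  have image: "coords x \<in> carr ?G" if "x \<in> carr L" for x
    unfolding carr_double_extension coords_def using that proj_in_H by simp
  have sclG: "scl ?G = (\<lambda>c (s, x, t). (c * s, scl L c x, c * t))"
    by (simp add: double_extension_def)
  show "linear_between (scl L) (carr L) (scl ?G) (carr ?G) coords"
    unfolding linear_between_def
    using image by (auto simp: sclG coords_def proj_add proj_scale form_add form_scale z_in e_in)
  have "inj_on coords (carr L)"
    by (rule inj_onI) (metis coords_decomposition coords_def prod.inject)
  moreover have "carr ?G \<subseteq> coords ` carr L"
  proof
    fix p assume "p \<in> carr ?G"
    then obtain s x t where p: "p = (s, x, t)" "x \<in> carr H" unfolding carr_double_extension by auto
    note x = carr_HD[OF p(2)]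
    let ?y = "x + scl L s z + scl L t e"
    have "?y \<in> carr L" using x z_in e_in by (simp add: carr_add carr_scale)
    moreover have "coords ?y = p"
      unfolding p coords_def using x z_in e_in
      by (simp add: form_add form_scale carr_add carr_scale proj_add proj_scale proj_z proj_e
          proj_fixes e_z z_z e_e z_e)
    ultimately show "p \<in> coords ` carr L" by blast
  qed
  ultimately show "bij_betw coords (carr L) (carr ?G)" using image unfolding bij_betw_def by blast
  show "coords ` part L \<alpha> \<subseteq> part ?G \<alpha>" for \<alpha>
  proof
    fix p assume "p \<in> coords ` part L \<alpha>"
    then obtain x where x: "x \<in> part L \<alpha>" "p = coords x" by blast
    show "p \<in> part ?G \<alpha>"
    proof (cases "\<alpha> = 0")
      case True
      then have "B z x = 0" using form_odd[OF z_even] x by simp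
      then show ?thesis using proj_part[OF x(1)] True x(2) by (simp add: coords_def double_extension_def)
    next
      case False
      then have "B e x = 0" using form_odd[OF e_odd] x by simp
      then show ?thesis using proj_part[OF x(1)] False x(2) by (simp add: coords_def double_extension_def)
    qed
  qed
  fix x y assume x: "x \<in> carr L" and y: "y \<in> carr L"
  show "coords (brac L x y) = brac ?G (coords x) (coords y)" by (rule coords_brac[OF x y])
  show "double_extension_form B (coords x) (coords y) = B x y" by (rule coords_form[OF x y])
  show "double_extension_symplectic H B red_delta ext_shift \<mu> (coords x) (coords y) = \<omega> x y"
    unfolding double_extension_symplectic_def coords_delta[OF x, symmetric]
    using coords_form[OF delta_in[OF x] y] omega_eq[OF x y] by simp
qed

corollary generalized_double_extension_H:
  "generalized_odd_double_extension_of L B \<omega> H B \<omega>"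
  unfolding generalized_odd_double_extension_of_def
  using double_extension_data_H coords_isometric_isomorphism by blast

end

section \<open>Odd-symplectic odd-Manin superalgebras are double extensions\<close>

theorem proposition6p5:
  fixes G :: "('k::{alg_closed_field, field_char_0}, 'a::ab_group_add) superalg"
    and \<aa> \<bb> :: "'a set"
    and B \<omega> :: "'a \<Rightarrow> 'a \<Rightarrow> 'k"
  assumes "special_odd_symplectic_odd_manin G \<aa> \<bb> B \<omega>"
    and "carr G \<noteq> {0}"
  shows "\<exists>(H :: ('k, 'a) superalg) \<aa>\<^sub>H \<bb>\<^sub>H B\<^sub>H \<omega>\<^sub>H.
    special_odd_symplectic_odd_manin H \<aa>\<^sub>H \<bb>\<^sub>H B\<^sub>H \<omega>\<^sub>H \<and>
    generalized_odd_double_extension_of G B \<omega> H B\<^sub>H \<omega>\<^sub>H"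
proof -
  have G: "lie_superalgebra G" "odd_quadratic G B" "odd_symplectic G \<omega>"
    using assms(1) unfolding special_odd_symplectic_odd_manin_def by blast+
  interpret G: odd_symplectic_quadratic G B \<omega>
    using G by (simp add: odd_symplectic_quadratic_def odd_quadratic_lie_def
        odd_quadratic_lie_axioms_def odd_symplectic_quadratic_axioms_def)
  obtain \<delta> where \<delta>: "symplectic_derivation G B \<omega> \<delta>" using G.symplectic_derivation_exists by blast
  interpret G: with_symplectic_derivation_closed G B \<omega> \<delta>
    by unfold_locales (rule \<delta>)
  obtain z \<mu> where z: "z \<in> part G 0" "z \<noteq> 0" "\<mu> \<noteq> 0" "\<delta> z = scl G \<mu> z"
    "\<forall>x\<in>carr G. brac G z x = 0"
    using G.central_even_eigenvector[OF assms(2)] by blast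
  obtain y where y: "y \<in> part G 1" "B z y \<noteq> 0"
    using G.form_nondegenerate_homogeneous[OF z(1)] z(2) by auto
  let ?e = "scl G (1 / B z y) y"
  interpret R: central_reduction G B \<omega> \<delta> z ?e \<mu>
    using z y by unfold_locales (simp_all add: G.part_scale G.form_scale G.part_in)
  interpret H: with_symplectic_derivation_closed R.H B \<omega> R.red_delta
    using R.lie_superalgebra_H R.odd_quadratic_H R.odd_symplectic_H R.symplectic_derivation_H
    by (simp add: with_symplectic_derivation_closed_def with_symplectic_derivation_def
        with_symplectic_derivation_axioms_def odd_symplectic_quadratic_def odd_quadratic_lie_def
        odd_quadratic_lie_axioms_def odd_symplectic_quadratic_axioms_def)
  show ?thesis
    using H.manin_decomposition_exists R.generalized_double_extension_H by blast
qed

end
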